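(* As a formal power series in $z$ and $w$, $$\sum_{x\ge0,\ y\ge0} G_H(x,y)\,z^xw^y=\frac{\dfrac{\sqrt2\,(1-w/z)}{\sqrt{1-w^2}}+\dfrac{2-z/w-1/(zw)}{\sqrt{1-z^2}}}{4-w/z-z/w-zw-1/(zw)},$$ and as a formal power series in $1/z$ and $w$, $$\sum_{x<0,\ y\ge0} G_H(x,y)\,z^xw^y=\frac{\dfrac{\sqrt2\,(w/z-1)}{\sqrt{1-w^2}}+\sqrt{1-1/z^2}}{4-w/z-z/w-zw-1/(zw)},$$ where both sums run over $(x,y)$ with $x+y$ even. (In the first formula numerator and denominator are multiplied by $zw$ and expanded in powers of $z,w$; in the second they are multiplied by $w/z$ and expanded in powers of $1/z,w$. All square roots are the power series with constant term $1$.)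
   Context: Consider $\mathbb{Z}^2$ with unit conductances and Laplacian $\Delta f(v)=\sum_{v'\sim v}(f(v)-f(v'))$. Let $D=\{(k,k): k\in\mathbb{Z},\ k\le -1\}$ and let $G_D$ be the Green's function on $\mathbb{Z}^2\setminus D$ with Dirichlet boundary conditions on $D$ (the inverse of the Laplacian acting on functions vanishing on $D$; equivalently $G_D(u,v)$ is the expected total time spent at $v$, before hitting $D$, by the continuous-time random walk started at $u$ that jumps at rate $1$ along each edge). For $(x,y)\in\mathbb{Z}^2$ with $x+y$ even and $y\ge 0$ define $$G_H(x,y)=2\,G_D\left((0,0),\Big(\frac{x-y}{2},\frac{x+y}{2}\Big)\right).$$ *)

theory Defs
  imports "HOL-Probability.Probability" "HOL-Computational_Algebra.Formal_Power_Series"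
begin

section \<open>The Green's function of the slit plane\<close>

text \<open>
  The continuous-time random walk on the square lattice is realised by its jump chain and its
  holding times.  A sample \<open>\<omega>\<close> is an i.i.d. sequence of pairs: \<open>fst (\<omega> n)\<close> is the time spent at the
  \<open>n\<close>-th site and \<open>snd (\<omega> n)\<close> is the step then taken.  Jumping at rate 1 along each of the four
  incident edges means that the holding times are exponential of rate 4 and that the steps are
  uniform and independent of the holding times.
\<close>

definition step_pmf :: "(int \<times> int) pmf" where
  "step_pmf = pmf_of_set {(1, 0), (-1, 0), (0, 1), (0, -1)}"

definition walk_measure :: "(nat \<Rightarrow> real \<times> (int \<times> int)) measure" where
  "walk_measure =
     Pi\<^sub>M UNIV (\<lambda>_. density lborel (\<lambda>t. ennreal (exponential_density 4 t)) \<Otimes>\<^sub>M measure_pmf step_pmf)"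

definition jump_time :: "(nat \<Rightarrow> real \<times> (int \<times> int)) \<Rightarrow> nat \<Rightarrow> real" where
  "jump_time \<omega> n = (\<Sum>k<n. fst (\<omega> k))"

definition jump_chain :: "int \<times> int \<Rightarrow> (nat \<Rightarrow> real \<times> (int \<times> int)) \<Rightarrow> nat \<Rightarrow> int \<times> int" where
  "jump_chain u \<omega> n = u + (\<Sum>k<n. snd (\<omega> k))"

text \<open>
  \<open>walk_at u \<omega> t v\<close>: the walk started at \<open>u\<close> is at \<open>v\<close> at time \<open>t\<close>.  A relation is used rather than
  a function of \<open>t\<close> so that nothing has to be said about the null event of an explosion.
\<close>

definition walk_at :: "int \<times> int \<Rightarrow> (nat \<Rightarrow> real \<times> (int \<times> int)) \<Rightarrow> real \<Rightarrow> int \<times> int \<Rightarrow> bool" where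
  "walk_at u \<omega> t v \<longleftrightarrow> (\<exists>n. jump_time \<omega> n \<le> t \<and> t < jump_time \<omega> (Suc n) \<and> jump_chain u \<omega> n = v)"

definition time_before_hitting ::
  "(int \<times> int) set \<Rightarrow> int \<times> int \<Rightarrow> int \<times> int \<Rightarrow> (nat \<Rightarrow> real \<times> (int \<times> int)) \<Rightarrow> ennreal" where
  "time_before_hitting B u v \<omega> =
     emeasure lborel {t. walk_at u \<omega> t v \<and> (\<forall>s\<le>t. \<forall>d\<in>B. \<not> walk_at u \<omega> s d)}"

definition dirichlet_green :: "(int \<times> int) set \<Rightarrow> int \<times> int \<Rightarrow> int \<times> int \<Rightarrow> real" where
  "dirichlet_green B u v = enn2real (\<integral>\<^sup>+ \<omega>. time_before_hitting B u v \<omega> \<partial>walk_measure)"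

definition slit :: "(int \<times> int) set" where
  "slit = {(k, k) | k. k \<le> -1}"

text \<open>Only used for \<open>x + y\<close> even, where both divisions are exact.\<close>

definition G_H :: "int \<Rightarrow> int \<Rightarrow> real" where
  "G_H x y = 2 * dirichlet_green slit (0, 0) ((x - y) div 2, (x + y) div 2)"

section \<open>Formal power series in two variables\<close>

text \<open>
  A series in two variables is a series in the second variable whose coefficients are series in
  the first: the coefficient of (first)\<open>^i\<close> (second)\<open>^j\<close> in \<open>F\<close> is
  \<open>fps_nth (fps_nth F j) i\<close>.
\<close>

definition fps2 :: "(nat \<Rightarrow> nat \<Rightarrow> real) \<Rightarrow> real fps fps" where
  "fps2 a = Abs_fps (\<lambda>j. Abs_fps (\<lambda>i. a i j))"

definition fps2_var1 :: "real fps fps" where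
  "fps2_var1 = fps_const fps_X"

definition fps2_var2 :: "real fps fps" where
  "fps2_var2 = fps_X"

definition fps2_const :: "real \<Rightarrow> real fps fps" where
  "fps2_const c = fps_const (fps_const c)"

definition fps2_sqrt :: "real fps fps \<Rightarrow> real fps fps" where
  "fps2_sqrt F = (THE S. S ^ 2 = F \<and> fps_nth (fps_nth S 0) 0 = 1)"

end

theory Submission
  imports Defs
begin

text \<open>
  In the rotated coordinates \<open>x = a + b\<close>, \<open>y = b - a\<close> of a lattice point \<open>(a, b)\<close> every step changes
  both coordinates by \<open>1\<close> or \<open>- 1\<close>, and the slit becomes the even part of the negative \<open>x\<close>-axis.
  The functions \<open>\<zeta>\<^sup>x r\<^sup>y\<close> with \<open>(\<zeta> + 1/\<zeta>) (r + 1/r) = 4\<close> are harmonic for this walk.  For real \<open>r\<close> the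
  value \<open>\<zeta> = - \<i> (1 + \<i> r) / (1 - \<i> r)\<close> satisfies the relation and lies on the unit circle, so
  \<open>H(x, y) = (\<surd>2 / \<pi>) \<integral>\<^sub>0\<^sup>\<pi> (cos t)\<^sup>y Re (\<zeta>(cos t)\<^sup>x / (1 - \<i> cos t)) dt\<close>
  (constant \<open>slit_pot\<close>) is harmonic for \<open>y > 0\<close>.  It is the Fourier integral of the harmonic
  extension of \<open>(1 - z\<^sup>2)\<^sup>-\<^sup>1\<^sup>/\<^sup>2\<close>, the reciprocal Wiener--Hopf factor of the walk observed on the \<open>x\<close>-axis, after the
  substitution that makes the decay rate in \<open>y\<close> the integration variable.

  Extended by \<open>H(x, \<bar>y\<bar>)\<close>, this function vanishes on the slit and is harmonic off the slit up to a
  source at the origin.  On the axis both properties come from one exact derivative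
  (\<open>kern_antiderivative\<close>), which gives \<open>x H(x, 0) = (x - 1) H(x - 2, 0)\<close>, together with a reflection
  identity (\<open>slit_pot_axis\<close>) that expresses the Laplacian of \<open>H\<close> at \<open>(x, 0)\<close> through
  \<open>H(- x, 0)\<close> and \<open>H(- x - 2, 0)\<close>.

  To identify \<open>H\<close> with the Green's function, first-step analysis shows that the expected occupation
  time is the Neumann series \<open>\<Sum>n. Q\<^sup>n (\<delta>/4)\<close> of the averaging operator \<open>Q\<close> killed on the slit.  The
  Poisson equation \<open>h = Q h + \<delta>/4\<close> for \<open>h = H/2\<close> leaves the remainder \<open>Q\<^sup>n h\<close>, which must tend to \<open>0\<close>
  (\<open>dirichlet_green_eqI\<close>).  Since \<open>H\<close> tends to \<open>0\<close> as \<open>\<bar>y\<bar> \<rightarrow> \<infinity>\<close>, uniformly in \<open>x\<close>, and \<open>y\<close> performs a simple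
  random walk on the integers, which leaves every finite interval with probability tending to \<open>1\<close>, it
  does (\<open>killed_iter_tendsto_0\<close>).

  For the generating functions, multiplying by the kernel in the denominator kills all coefficients
  in the interior of a quadrant; what is left are values of \<open>H\<close> next to the axes.  On the \<open>x\<close>-axis
  these are the coefficients of \<open>(1 - z\<^sup>2)\<^sup>-\<^sup>1\<^sup>/\<^sup>2\<close>.  In the columns \<open>x = 0\<close> and \<open>x = - 1\<close> the factor
  \<open>1 + r\<^sup>2\<close> in the denominator of the integrand cancels in \<open>H(x, y) + H(x, y + 2)\<close>, which
  leaves \<open>\<surd>2\<close> times a coefficient of \<open>(1 - w\<^sup>2)\<^sup>-\<^sup>1\<^sup>/\<^sup>2\<close> (\<open>slit_pot_column_0\<close>, \<open>slit_pot_column_minus_1\<close>).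
\<close>

section \<open>Averages against the arcsine law\<close>

text \<open>
  The substitution \<open>r = cos t\<close> turns the singular weight \<open>1 / \<surd>(1 - r\<^sup>2)\<close> on \<open>[- 1, 1]\<close> into a constant, so
  that all integrands are continuous on a compact interval.
\<close>

definition arcsine_mean :: "(real \<Rightarrow> real) \<Rightarrow> real" where
  "arcsine_mean f = integral {0..pi} (\<lambda>t. f (cos t)) / pi"

lemma continuous_comp_cos:
  fixes f :: "real \<Rightarrow> real"
  shows "continuous_on UNIV f \<Longrightarrow> continuous_on S (\<lambda>t. f (cos t))"
  by (rule continuous_on_compose2[where t = UNIV]) (auto intro: continuous_intros)

lemma integrable_comp_cos:
  fixes f :: "real \<Rightarrow> real"
  shows "continuous_on UNIV f \<Longrightarrow> (\<lambda>t. f (cos t)) integrable_on {0..pi}"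
  by (intro integrable_continuous_real continuous_comp_cos)

lemma arcsine_mean_add:
  assumes "continuous_on UNIV f" "continuous_on UNIV g"
  shows "arcsine_mean (\<lambda>r. f r + g r) = arcsine_mean f + arcsine_mean g"
  unfolding arcsine_mean_def
  by (subst integral_add) (auto intro: integrable_comp_cos assms simp: add_divide_distrib)

lemma arcsine_mean_diff:
  assumes "continuous_on UNIV f" "continuous_on UNIV g"
  shows "arcsine_mean (\<lambda>r. f r - g r) = arcsine_mean f - arcsine_mean g"
  unfolding arcsine_mean_def
  by (subst integral_diff) (auto intro: integrable_comp_cos assms simp: diff_divide_distrib)

lemma arcsine_mean_cmult: "arcsine_mean (\<lambda>r. c * f r) = c * arcsine_mean f"
  by (simp add: arcsine_mean_def)

lemma arcsine_mean_abs_le: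
  assumes "continuous_on UNIV f" "continuous_on UNIV g" "\<And>r. \<bar>r\<bar> \<le> 1 \<Longrightarrow> \<bar>f r\<bar> \<le> g r"
  shows "\<bar>arcsine_mean f\<bar> \<le> arcsine_mean g"
proof -
  have "norm (integral {0..pi} (\<lambda>t. f (cos t))) \<le> integral {0..pi} (\<lambda>t. g (cos t))"
    by (rule integral_norm_bound_integral) (auto intro!: integrable_comp_cos assms)
  thus ?thesis by (simp add: arcsine_mean_def divide_right_mono)
qed

text \<open>
  Wallis' integrals; for even \<open>n = 2 k\<close> the value is \<open>(2k choose k) / 4\<^sup>k\<close>, the coefficient of \<open>z\<^sup>n\<close> in
  \<open>(1 - z\<^sup>2)\<^sup>-\<^sup>1\<^sup>/\<^sup>2\<close>.\<close>

definition wallis :: "nat \<Rightarrow> real" where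
  "wallis n = arcsine_mean (\<lambda>r. r ^ n)"

lemma wallis_0: "wallis 0 = 1"
  by (simp add: wallis_def arcsine_mean_def)

lemma wallis_Suc_0: "wallis (Suc 0) = 0"
proof -
  have "(cos has_integral (sin pi - sin 0)) {0..pi}"
    by (intro fundamental_theorem_of_calculus)
       (auto intro!: derivative_eq_intros simp: has_real_derivative_iff_has_vector_derivative[symmetric])
  thus ?thesis by (simp add: wallis_def arcsine_mean_def integral_unique)
qed

lemma wallis_recurrence: "real (n + 2) * wallis (n + 2) = real (n + 1) * wallis n"
proof -
  have "((\<lambda>t. real (n + 2) * cos t ^ (n + 2) - real (n + 1) * cos t ^ n) has_integral
      (sin pi * cos pi ^ (n + 1) - sin 0 * cos 0 ^ (n + 1))) {0..pi}"
  proof (rule fundamental_theorem_of_calculus)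
    fix t :: real
    have "cos t * cos t ^ (n + 1) - sin t * (real (n + 1) * (sin t * cos t ^ n))
       = cos t ^ (n + 2) - real (n + 1) * ((sin t)\<^sup>2 * cos t ^ n)"
      by (simp add: power2_eq_square algebra_simps)
    also have "\<dots> = real (n + 2) * cos t ^ (n + 2) - real (n + 1) * cos t ^ n"
      unfolding sin_squared_eq by (simp add: power2_eq_square algebra_simps)
    finally have eq: "cos t * cos t ^ (n + 1) - sin t * (real (n + 1) * (sin t * cos t ^ n))
       = real (n + 2) * cos t ^ (n + 2) - real (n + 1) * cos t ^ n" .
    have "((\<lambda>t. sin t * cos t ^ (n + 1)) has_real_derivative
       cos t * cos t ^ (n + 1) - sin t * (real (n + 1) * (sin t * cos t ^ n))) (at t within {0..pi})"
      by (rule derivative_eq_intros refl)+ (simp add: algebra_simps)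
    thus "((\<lambda>t. sin t * cos t ^ (n + 1)) has_vector_derivative
       real (n + 2) * cos t ^ (n + 2) - real (n + 1) * cos t ^ n) (at t within {0..pi})"
      unfolding eq has_real_derivative_iff_has_vector_derivative .
  qed simp
  hence "integral {0..pi} (\<lambda>t. real (n + 2) * cos t ^ (n + 2) - real (n + 1) * cos t ^ n) = 0"
    by (simp add: integral_unique)
  hence "arcsine_mean (\<lambda>r. real (n + 2) * r ^ (n + 2) - real (n + 1) * r ^ n) = 0"
    unfolding arcsine_mean_def by (simp only: div_0)
  thus ?thesis
    by (simp only: arcsine_mean_diff arcsine_mean_cmult continuous_intros right_minus_eq wallis_def)
qed

lemma wallis_odd: "odd n \<Longrightarrow> wallis n = 0"
proof (induction n rule: induct_nat_012)
  case (ge2 n)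
  thus ?case using wallis_recurrence[of n] by simp
qed (simp_all add: wallis_Suc_0)

text \<open>
  Used twice: for the decay of \<open>slit_pot\<close> away from the axis and for the decay of the transition
  probabilities of simple random walk.
\<close>

lemma arcsine_mean_abs_power_tendsto_0:
  "(\<lambda>n. arcsine_mean (\<lambda>r. \<bar>r\<bar> ^ n)) \<longlonglongrightarrow> 0"
proof -
  define g where "g = (\<lambda>t::real. if t \<in> {0, pi} then 1 else 0 :: real)"
  have lim: "(\<lambda>n. integral {0..pi} (\<lambda>t. \<bar>cos t\<bar> ^ n)) \<longlonglongrightarrow> integral {0..pi} g"
  proof (rule dominated_convergence(2)[where h = "\<lambda>_. 1"])
    fix t :: real assume t: "t \<in> {0..pi}"
    show "(\<lambda>n. \<bar>cos t\<bar> ^ n) \<longlonglongrightarrow> g t"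
    proof (cases "t \<in> {0, pi}")
      case False
      hence "0 < t" "t < pi" using t by auto
      hence "cos t < cos 0" "cos pi < cos t" by (intro cos_monotone_0_pi; simp)+
      hence "\<bar>cos t\<bar> < 1" by simp
      thus ?thesis using False by (simp add: g_def LIMSEQ_power_zero)
    qed (auto simp: g_def)
  qed (auto intro!: integrable_continuous_real continuous_intros power_le_one)
  have "integral {0..pi} g = integral {0..pi} (\<lambda>_. 0 :: real)"
    by (rule integral_spike[of "{0, pi}"]) (auto simp: g_def)
  hence "integral {0..pi} g = 0" by simp
  thus ?thesis using tendsto_divide[OF lim tendsto_const[of pi]] by (simp add: arcsine_mean_def)
qed

section \<open>A family of product harmonic functions\<close>

text \<open>
  With \<open>r = tan (\<pi>/4 - \<theta>/2)\<close>, \<open>0 < \<theta> < \<pi>\<close>, this is \<open>e\<^sup>-\<^sup>\<i>\<^sup>\<theta>\<close> written rationally in \<open>r\<close>; the number \<open>r\<close> is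
  the factor by which the bounded harmonic extension of the character \<open>e\<^sup>\<i>\<^sup>\<theta>\<^sup>x\<close> decays in \<open>y\<close>.
\<close>

definition cayley :: "real \<Rightarrow> complex" where
  "cayley r = - \<i> * (1 + \<i> * of_real r) / (1 - \<i> * of_real r)"

text \<open>
  The factor \<open>1 / (1 - \<i> r)\<close> comes from \<open>(1 - \<zeta>\<^sup>-\<^sup>2)\<^sup>-\<^sup>1\<^sup>/\<^sup>2 d\<theta>\<close>, which equals \<open>\<surd>2 dr / ((1 - \<i> r) \<surd>(1 - r\<^sup>2))\<close> up to
  sign and whose last factor is the arcsine weight.  The real part combines \<open>\<theta>\<close> with \<open>- \<theta>\<close>.
\<close>

definition kern :: "int \<Rightarrow> real \<Rightarrow> real" where
  "kern x r = Re (cayley r powi x / (1 - \<i> * of_real r))"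

lemma one_pm_ii_nonzero [simp]:
  "1 + \<i> * complex_of_real r \<noteq> 0" "1 - \<i> * complex_of_real r \<noteq> 0"
  by (auto simp: complex_eq_iff)

lemma one_plus_square_nonzero [simp]: "1 + (complex_of_real r)\<^sup>2 \<noteq> 0" "1 + r\<^sup>2 \<noteq> 0"
proof -
  have "1 + r\<^sup>2 > 0" by (simp add: add_pos_nonneg)
  thus "1 + r\<^sup>2 \<noteq> 0" by simp
  thus "1 + (complex_of_real r)\<^sup>2 \<noteq> 0" 
   by (metis of_real_1 of_real_add of_real_eq_0_iff of_real_power)
qed

lemma cnj_cayley: "cnj (cayley r) = inverse (cayley r)"
proof -
  have "cnj (cayley r) * cayley r = 1"
    using one_plus_square_nonzero(1)[of r]
    by (simp add: cayley_def divide_simps power2_eq_square)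
  thus ?thesis by (metis inverse_unique mult.commute)
qed

lemma norm_cayley [simp]: "norm (cayley r) = 1"
proof -
  have "norm (1 - \<i> * complex_of_real r) = norm (cnj (1 + \<i> * complex_of_real r))"
    by simp
  also have "\<dots> = norm (1 + \<i> * complex_of_real r)"
    by (rule complex_mod_cnj)
  finally show ?thesis
    by (simp add: cayley_def norm_mult norm_divide)
qed

lemma cayley_nonzero [simp]: "cayley r \<noteq> 0"
  using norm_cayley[of r] by (metis norm_zero zero_neq_one)

lemma cnj_cayley_powi: "cnj (cayley r powi x) = cayley r powi (- x)"
proof -
  have "cnj (cayley r powi x) = cnj (cayley r) powi x"
    by (cases x rule: int_cases4) (simp_all add: power_int_minus)
  thus ?thesis by (simp add: cnj_cayley power_int_minus power_int_inverse)
qed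

lemma one_plus_square: "(1 + \<i> * complex_of_real r) * (1 - \<i> * complex_of_real r) = of_real (1 + r\<^sup>2)"
  by (simp add: algebra_simps power2_eq_square)

lemma cayley_add_inverse: "cayley r + inverse (cayley r) = of_real (4 * r / (1 + r\<^sup>2))"
proof -
  have "cayley r + inverse (cayley r) = cayley r + cnj (cayley r)" by (simp add: cnj_cayley)
  also have "\<dots> = of_real (4 * r / (1 + r\<^sup>2))"
    using one_plus_square[of r]
    by (simp add: cayley_def divide_simps mult.commute) (simp add: algebra_simps power2_eq_square)
  finally show ?thesis .
qed

text \<open>
  The relation \<open>\<zeta> + 1/\<zeta> = 4 / (r + 1/r)\<close> in the form needed for harmonicity.
\<close>

lemma kern_neighbours: "kern (x + 1) r + kern (x - 1) r = 4 * r / (1 + r\<^sup>2) * kern x r"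
proof -
  have "kern (x + 1) r + kern (x - 1) r
      = Re ((cayley r + inverse (cayley r)) * (cayley r powi x / (1 - \<i> * of_real r)))"
    unfolding kern_def plus_complex.sel[symmetric]
    by (intro arg_cong[where f = Re]) (simp add: power_int_add power_int_diff divide_inverse ring_distribs)
  also have "\<dots> = 4 * r / (1 + r\<^sup>2) * kern x r"
    unfolding cayley_add_inverse kern_def by (simp only: times_complex.sel Re_complex_of_real Im_complex_of_real)
  finally show ?thesis .
qed

lemma kern_minus: "kern (- x) r = Re (cayley r powi x / (1 + \<i> * of_real r))"
proof -
  have "kern (- x) r = Re (cnj (cayley r powi (- x) / (1 - \<i> * of_real r)))"
    by (simp only: kern_def cnj.sel)
  also have "\<dots> = Re (cayley r powi x / (1 + \<i> * of_real r))"
    unfolding complex_cnj_divide cnj_cayley_powi by simp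
  finally show ?thesis .
qed

text \<open>
  Complex conjugation inverts \<open>\<zeta>\<close> and so replaces \<open>x\<close> by \<open>- x\<close>.  The factor \<open>(1 - r\<^sup>2) / (1 + r\<^sup>2) = \<bar>sin \<theta>\<bar>\<close> is
  the symbol of \<open>1\<close> minus the transition operator of the walk observed on the axis; it splits as
  \<open>(1 - \<zeta>\<^sup>2)\<^sup>1\<^sup>/\<^sup>2\<close> times its conjugate, up to the factor \<open>1/2\<close>.  One factor cancels against the one in the
  kernel, the other replaces it by its conjugate.
\<close>

lemma kern_reflect:
  "2 * (1 - r\<^sup>2) / (1 + r\<^sup>2) * kern x r = kern (- x) r - kern (- x - 2) r"
proof -
  have sq: "1 - (cayley r)\<^sup>2 = 2 * of_real (1 - r\<^sup>2) / (1 - \<i> * of_real r)\<^sup>2"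
    by (simp add: cayley_def divide_simps power_mult_distrib) (simp add: algebra_simps power2_eq_square)
  have "kern (- x - 2) r = kern (- (x + 2)) r" by simp
  hence "kern (- x) r - kern (- x - 2) r
     = Re (cayley r powi x * ((1 - (cayley r)\<^sup>2) / (1 + \<i> * of_real r)))"
    unfolding \<open>kern (- x - 2) r = kern (- (x + 2)) r\<close> kern_minus minus_complex.sel[symmetric]
    by (intro arg_cong[where f = Re]) (simp add: power_int_add divide_inverse algebra_simps)
  also have "(1 - (cayley r)\<^sup>2) / (1 + \<i> * of_real r)
     = of_real (2 * (1 - r\<^sup>2) / (1 + r\<^sup>2)) / (1 - \<i> * of_real r)"
    unfolding sq of_real_divide one_plus_square[symmetric] by (simp add: power2_eq_square divide_simps)
  also have "Re (cayley r powi x * \<dots>)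
     = Re (of_real (2 * (1 - r\<^sup>2) / (1 + r\<^sup>2)) * (cayley r powi x / (1 - \<i> * of_real r)))"
    by (simp only: times_divide_eq_right mult.commute[of "cayley r powi x"] times_divide_eq_left)
  also have "\<dots> = 2 * (1 - r\<^sup>2) / (1 + r\<^sup>2) * kern x r"
    unfolding kern_def by (simp only: times_complex.sel Re_complex_of_real Im_complex_of_real)
  finally show ?thesis by simp
qed

lemma kern_0: "kern 0 r = 1 / (1 + r\<^sup>2)"
  by (simp add: kern_def Re_divide power2_eq_square)

lemma kern_minus_1: "kern (- 1) r = r / (1 + r\<^sup>2)"
proof -
  have "cayley r powi (- 1) / (1 - \<i> * of_real r) = \<i> / (1 + \<i> * of_real r)"
    by (simp add: cayley_def power_int_minus divide_simps)
  thus ?thesis by (simp add: kern_def Re_divide power2_eq_square)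
qed

lemma abs_kern_le_1: "\<bar>kern x r\<bar> \<le> 1"
proof -
  have "\<bar>kern x r\<bar> \<le> norm (cayley r powi x / (1 - \<i> * of_real r))"
    unfolding kern_def by (rule abs_Re_le_cmod)
  also have "\<dots> = 1 / norm (1 - \<i> * complex_of_real r)"
    by (simp add: norm_divide norm_power_int)
  also have "\<dots> \<le> 1"
    using abs_Re_le_cmod[of "1 - \<i> * complex_of_real r"] by (simp add: divide_simps)
  finally show ?thesis .
qed

lemma continuous_kern [continuous_intros]:
  "continuous_on S f \<Longrightarrow> continuous_on S (\<lambda>t. kern x (f t))"
  unfolding kern_def cayley_def by (intro continuous_intros) (auto simp flip: cayley_def)

text \<open>
  In terms of \<open>s = \<zeta>\<^sup>-\<^sup>2\<close> the function differentiated is the imaginary part of a multiple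
  of \<open>s\<^sup>-\<^sup>x\<^sup>/\<^sup>2 (1 - s)\<^sup>1\<^sup>/\<^sup>2\<close>, and the identity is the differential equation \<open>(1 - s) f' = f / 2\<close> of \<open>f = (1 - s)\<^sup>-\<^sup>1\<^sup>/\<^sup>2\<close> on the level of Fourier
  coefficients.  The factor \<open>sin t\<close> vanishes at both ends of the interval.
\<close>

lemma kern_antiderivative:
  "((\<lambda>t. Im (cayley (cos t) powi x * (of_real (sin t) / (1 + \<i> * of_real (cos t)))))
     has_vector_derivative (real_of_int (x - 1) * kern (x - 2) (cos t) - real_of_int x * kern x (cos t)))
     (at t within S)"
proof -
  define c s where "c = complex_of_real (cos t)" and "s = complex_of_real (sin t)"
  have cs: "s\<^sup>2 = 1 - c\<^sup>2"
    unfolding c_def s_def of_real_power[symmetric] sin_squared_eq by simp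
  have nz: "1 + \<i> * c \<noteq> 0" "1 - \<i> * c \<noteq> 0" by (simp_all add: c_def)
  define Z where "Z = (\<lambda>t::complex. - \<i> * (1 + \<i> * cos t) / (1 - \<i> * cos t))"
  define z where "z = - \<i> * (1 + \<i> * c) / (1 - \<i> * c)"
  have z: "z = cayley (cos t)" by (simp add: z_def cayley_def c_def)
  have Zt: "Z (of_real t) = z" by (simp add: Z_def z_def c_def cos_of_real)
  have sin_t: "sin (complex_of_real t) = s" and cos_t: "cos (complex_of_real t) = c"
    by (simp_all add: s_def c_def sin_of_real cos_of_real)
  have znz: "z \<noteq> 0" by (simp add: z)
  have dZ: "(Z has_field_derivative (- 2 * s / (1 - \<i> * c)\<^sup>2)) (at (of_real t))"
    unfolding Z_def using nz
    by (auto intro!: derivative_eq_intros simp: cos_t sin_t)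
       (simp add: divide_simps power2_eq_square, simp add: algebra_simps)
  have dG: "((\<lambda>t. sin t / (1 + \<i> * cos t)) has_field_derivative (\<i> * (1 - \<i> * c) / (1 + \<i> * c)\<^sup>2)) (at (of_real t))"
    using nz
    by (auto intro!: derivative_eq_intros simp: cos_t sin_t)
       (use cs in \<open>simp add: divide_simps power2_eq_square\<close>, simp add: algebra_simps,
        metis distrib_left mult_1_right)
  have dF: "((\<lambda>t. Z t powi x * (sin t / (1 + \<i> * cos t))) has_field_derivative
      (of_int x * z powi (x - 1) * (- 2 * s / (1 - \<i> * c)\<^sup>2) * (s / (1 + \<i> * c))
        + z powi x * (\<i> * (1 - \<i> * c) / (1 + \<i> * c)\<^sup>2))) (at (of_real t))"
    by (rule DERIV_cong[OF DERIV_mult[OF DERIV_power_int[OF dZ] dG]])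
       (use znz in \<open>simp_all add: Zt cos_t sin_t mult_ac\<close>)
  have eq: "of_int x * z powi (x - 1) * (- 2 * s / (1 - \<i> * c)\<^sup>2) * (s / (1 + \<i> * c))
        + z powi x * (\<i> * (1 - \<i> * c) / (1 + \<i> * c)\<^sup>2)
      = \<i> * (of_int (x - 1) * (z powi (x - 2) / (1 - \<i> * c)) - of_int x * (z powi x / (1 - \<i> * c)))"
  proof -
    have p1: "z powi (x - 1) = z powi (x - 2) * z" and p2: "z powi x = z powi (x - 2) * z\<^sup>2"
      using znz by (simp_all add: power_int_diff power2_eq_square)
    have "of_int x * z * (- 2 * s\<^sup>2 / ((1 - \<i> * c)\<^sup>2 * (1 + \<i> * c)))
        + z\<^sup>2 * (\<i> * (1 - \<i> * c) / (1 + \<i> * c)\<^sup>2)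
      = \<i> * (of_int (x - 1) * (1 / (1 - \<i> * c)) - of_int x * (z\<^sup>2 / (1 - \<i> * c)))"
      unfolding cs z_def using nz
      by (simp add: divide_simps power_mult_distrib) (simp add: algebra_simps power2_eq_square power_mult_distrib)
    hence "z powi (x - 2) * (of_int x * z * (- 2 * s\<^sup>2 / ((1 - \<i> * c)\<^sup>2 * (1 + \<i> * c)))
        + z\<^sup>2 * (\<i> * (1 - \<i> * c) / (1 + \<i> * c)\<^sup>2))
      = z powi (x - 2) * (\<i> * (of_int (x - 1) * (1 / (1 - \<i> * c)) - of_int x * (z\<^sup>2 / (1 - \<i> * c))))"
      by simp
    thus ?thesis unfolding p1 p2 by (simp add: algebra_simps power2_eq_square)
  qed
  have "((\<lambda>t. Z (of_real t) powi x * (sin (of_real t) / (1 + \<i> * cos (of_real t)))) has_vector_derivative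
     (\<i> * (of_int (x - 1) * (z powi (x - 2) / (1 - \<i> * c)) - of_int x * (z powi x / (1 - \<i> * c)))))
     (at t within S)"
    using has_vector_derivative_real_field[OF dF[unfolded eq]] .
  hence "((\<lambda>t. Im (Z (of_real t) powi x * (sin (of_real t) / (1 + \<i> * cos (of_real t))))) has_vector_derivative
     Im (\<i> * (of_int (x - 1) * (z powi (x - 2) / (1 - \<i> * c)) - of_int x * (z powi x / (1 - \<i> * c)))))
     (at t within S)"
    by (rule bounded_linear.has_vector_derivative[OF bounded_linear_Im])
  moreover have "Z (of_real t) = cayley (cos t)" for t
    by (simp add: Z_def cayley_def cos_of_real)
  moreover have "Im (\<i> * (of_int a * u - of_int b * v)) = of_int a * Re u - of_int b * Re v"
    for a b and u v :: complex by simp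
  ultimately show ?thesis
    by (simp only: kern_def cos_of_real sin_of_real c_def z)
qed

section \<open>The potential of the slit\<close>

text \<open>
  For even \<open>x + y\<close> twice the Green's function at the point with rotated coordinates \<open>(x, y)\<close>.
  The factor \<open>\<surd>2\<close> normalises the value at the origin to \<open>1\<close>.
\<close>

definition slit_pot :: "int \<Rightarrow> nat \<Rightarrow> real" where
  "slit_pot x y = sqrt 2 * arcsine_mean (\<lambda>r. r ^ y * kern x r)"

lemma slit_pot_harmonic:
  "slit_pot (x + 1) (Suc (Suc y)) + slit_pot (x - 1) (Suc (Suc y))
     + slit_pot (x + 1) y + slit_pot (x - 1) y = 4 * slit_pot x (Suc y)"
proof -
  have "slit_pot (x + 1) (Suc (Suc y)) + slit_pot (x - 1) (Suc (Suc y)) + slit_pot (x + 1) y + slit_pot (x - 1) y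
     = sqrt 2 * arcsine_mean (\<lambda>r. r ^ Suc (Suc y) * kern (x + 1) r + r ^ Suc (Suc y) * kern (x - 1) r
          + r ^ y * kern (x + 1) r + r ^ y * kern (x - 1) r)"
    unfolding slit_pot_def by (simp only: arcsine_mean_add continuous_intros ring_distribs)
  also have "(\<lambda>r. r ^ Suc (Suc y) * kern (x + 1) r + r ^ Suc (Suc y) * kern (x - 1) r
          + r ^ y * kern (x + 1) r + r ^ y * kern (x - 1) r) = (\<lambda>r. 4 * (r ^ Suc y * kern x r))"
  proof
    fix r :: real
    have "r ^ Suc (Suc y) * kern (x + 1) r + r ^ Suc (Suc y) * kern (x - 1) r
          + r ^ y * kern (x + 1) r + r ^ y * kern (x - 1) r
       = r ^ y * (1 + r\<^sup>2) * (kern (x + 1) r + kern (x - 1) r)"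
      by (simp add: algebra_simps power2_eq_square)
    thus "r ^ Suc (Suc y) * kern (x + 1) r + r ^ Suc (Suc y) * kern (x - 1) r
          + r ^ y * kern (x + 1) r + r ^ y * kern (x - 1) r = 4 * (r ^ Suc y * kern x r)"
      by (simp add: kern_neighbours)
  qed
  finally show ?thesis by (simp add: arcsine_mean_cmult slit_pot_def)
qed

text \<open>
  The left-hand side is the Laplacian at \<open>(x, 0)\<close> of the function extended symmetrically to \<open>y < 0\<close>.
\<close>

lemma slit_pot_axis:
  "4 * slit_pot x 0 - 2 * slit_pot (x + 1) 1 - 2 * slit_pot (x - 1) 1
     = 2 * (slit_pot (- x) 0 - slit_pot (- x - 2) 0)"
proof -
  have "4 * kern x r + 2 * kern (- x - 2) r = 2 * (r * kern (x + 1) r) + 2 * (r * kern (x - 1) r) + 2 * kern (- x) r" for r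
  proof -
    have "2 * (r * kern (x + 1) r) + 2 * (r * kern (x - 1) r) = 2 * r * (kern (x + 1) r + kern (x - 1) r)"
      by (simp add: algebra_simps)
    also have "\<dots> = 8 * r\<^sup>2 / (1 + r\<^sup>2) * kern x r"
      unfolding kern_neighbours by (simp add: power2_eq_square)
    also have "\<dots> = 4 * kern x r - 2 * (2 * (1 - r\<^sup>2) / (1 + r\<^sup>2) * kern x r)"
      by (simp add: divide_simps) (simp add: algebra_simps)
    finally show ?thesis unfolding kern_reflect by simp
  qed
  hence "arcsine_mean (\<lambda>r. 4 * kern x r + 2 * kern (- x - 2) r)
     = arcsine_mean (\<lambda>r. 2 * (r * kern (x + 1) r) + 2 * (r * kern (x - 1) r) + 2 * kern (- x) r)"
    by simp
  hence "4 * arcsine_mean (kern x) + 2 * arcsine_mean (kern (- x - 2))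
     = 2 * arcsine_mean (\<lambda>r. r * kern (x + 1) r) + 2 * arcsine_mean (\<lambda>r. r * kern (x - 1) r)
        + 2 * arcsine_mean (kern (- x))"
    by (simp only: arcsine_mean_add arcsine_mean_cmult continuous_intros)
  from arg_cong[OF this, of "\<lambda>a. sqrt 2 * a"] show ?thesis
    by (simp add: slit_pot_def algebra_simps)
qed

lemma slit_pot_recurrence: "of_int x * slit_pot x 0 = of_int (x - 1) * slit_pot (x - 2) 0"
proof -
  have "((\<lambda>t. of_int (x - 1) * kern (x - 2) (cos t) - of_int x * kern x (cos t)) has_integral
      (Im (cayley (cos pi) powi x * (of_real (sin pi) / (1 + \<i> * of_real (cos pi))))
       - Im (cayley (cos 0) powi x * (of_real (sin 0) / (1 + \<i> * of_real (cos 0)))))) {0..pi}"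
    by (rule fundamental_theorem_of_calculus[OF _ kern_antiderivative]) simp
  hence "integral {0..pi} (\<lambda>t. of_int (x - 1) * kern (x - 2) (cos t) - of_int x * kern x (cos t)) = 0"
    by (simp add: integral_unique)
  hence "arcsine_mean (\<lambda>r. of_int (x - 1) * kern (x - 2) r - of_int x * kern x r) = 0"
    unfolding arcsine_mean_def by (simp only: div_0)
  hence "of_int (x - 1) * arcsine_mean (kern (x - 2)) - of_int x * arcsine_mean (kern x) = 0"
    by (simp only: arcsine_mean_diff arcsine_mean_cmult continuous_intros)
  hence "of_int (x - 1) * arcsine_mean (kern (x - 2)) = of_int x * arcsine_mean (kern x)"
    by (simp only: right_minus_eq)
  from arg_cong[OF this, of "\<lambda>a. sqrt 2 * a"] show ?thesis
    by (simp add: slit_pot_def mult.left_commute del: of_int_diff)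
qed

text \<open>
  The integral of \<open>1 / (1 + cos\<^sup>2 t) = 2 / (3 + cos 2t)\<close>.  The obvious primitive with \<open>tan t\<close> is
  discontinuous at \<open>\<pi>/2\<close>; the one used here is smooth on the whole interval.
\<close>

lemma slit_pot_origin: "slit_pot 0 0 = 1"
proof -
  define q where "q = 3 + 2 * sqrt 2"
  have "sqrt 2 \<ge> 1" by simp
  hence q: "q \<ge> 5" unfolding q_def by linarith
  define F where "F = (\<lambda>t. (t - arctan (sin (2 * t) / (q + cos (2 * t)))) / sqrt 2)"
  have q2: "q\<^sup>2 = 6 * q - 1" by (simp add: q_def power2_eq_square algebra_simps)
  have "(F has_vector_derivative 1 / (1 + (cos t)\<^sup>2)) (at t within S)" for t S
  proof -
    have pos: "q + cos (2 * t) > 0" using q cos_ge_minus_one[of "2 * t"] by linarith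
    have pos3: "3 + cos (2 * t) > 0" using cos_ge_minus_one[of "2 * t"] by linarith
    have S2: "(sin (2 * t))\<^sup>2 = 1 - (cos (2 * t))\<^sup>2" by (rule sin_squared_eq)
    define u' where "u' = (2 * q * cos (2 * t) + 2) / (q + cos (2 * t))\<^sup>2"
    have du: "((\<lambda>t. sin (2 * t) / (q + cos (2 * t))) has_real_derivative u') (at t within S)"
    proof -
      have "((\<lambda>t. sin (2 * t) / (q + cos (2 * t))) has_real_derivative
          (2 * cos (2 * t) * (q + cos (2 * t)) + 2 * (sin (2 * t))\<^sup>2) / (q + cos (2 * t))\<^sup>2) (at t within S)"
        using pos by (auto intro!: derivative_eq_intros simp: power2_eq_square)
      also have "2 * cos (2 * t) * (q + cos (2 * t)) + 2 * (sin (2 * t))\<^sup>2 = 2 * q * cos (2 * t) + 2"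
        unfolding S2 by (simp add: algebra_simps power2_eq_square)
      finally show ?thesis unfolding u'_def .
    qed
    have "1 + (sin (2 * t) / (q + cos (2 * t)))\<^sup>2 = 2 * q * (3 + cos (2 * t)) / (q + cos (2 * t))\<^sup>2"
      using pos unfolding power_divide S2
      by (simp add: divide_simps) (use q2 in \<open>simp add: power2_eq_square algebra_simps\<close>)
    hence "inverse (1 + (sin (2 * t) / (q + cos (2 * t)))\<^sup>2) * u'
        = (2 * q * cos (2 * t) + 2) / (2 * q * (3 + cos (2 * t)))"
      using pos by (simp add: u'_def divide_simps)
    also have "\<dots> = 1 - sqrt 2 * (2 / (3 + cos (2 * t)))"
    proof -
      have "q * (3 - 2 * sqrt 2) = 1" by (simp add: q_def algebra_simps)
      thus ?thesis using q pos3 by (simp add: divide_simps) (simp add: algebra_simps)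
    qed
    finally have "(F has_real_derivative (1 - (1 - sqrt 2 * (2 / (3 + cos (2 * t))))) / sqrt 2) (at t within S)"
      unfolding F_def
      by (intro DERIV_cdivide DERIV_diff DERIV_ident)
         (use DERIV_chain2[OF DERIV_arctan du] in simp)
    also have "(1 - (1 - sqrt 2 * (2 / (3 + cos (2 * t))))) / sqrt 2 = 1 / (1 + (cos t)\<^sup>2)"
    proof -
      have "3 + cos (2 * t) = 2 * (1 + (cos t)\<^sup>2)" by (simp add: cos_double_cos)
      thus ?thesis by (simp only: divide_divide_eq_left[symmetric]) simp
    qed
    finally show ?thesis unfolding has_real_derivative_iff_has_vector_derivative .
  qed
  hence "((\<lambda>t. 1 / (1 + (cos t)\<^sup>2)) has_integral (F pi - F 0)) {0..pi}"
    by (intro fundamental_theorem_of_calculus) auto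
  thus ?thesis
    by (simp add: slit_pot_def arcsine_mean_def kern_0 integral_unique F_def)
qed

lemma slit_pot_positive_axis: "slit_pot (int (2 * k)) 0 = wallis (2 * k)"
proof (induction k)
  case (Suc k)
  have "real (2 * k + 2) * slit_pot (int (2 * Suc k)) 0 = real (2 * k + 2) * wallis (2 * Suc k)"
    using slit_pot_recurrence[of "int (2 * Suc k)"] wallis_recurrence[of "2 * k"] Suc
    by (simp add: algebra_simps)
  thus ?case by (metis Suc.IH mult_cancel_left of_nat_eq_0_iff add_is_0 zero_neq_numeral)
qed (simp add: slit_pot_origin wallis_0)

text \<open>
  The recurrence at \<open>x = 0\<close> has the coefficient \<open>0\<close> on the left and \<open>- 1\<close> on the right, so it forces
  the value at \<open>- 2\<close> to vanish, and then all further ones.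
\<close>

lemma slit_pot_slit: "slit_pot (- int (2 * Suc k)) 0 = 0"
proof (induction k)
  case 0
  show ?case using slit_pot_recurrence[of 0] by simp
next
  case (Suc k)
  have *: "- int (2 * Suc k) - 2 = - int (2 * Suc (Suc k))" by simp
  have "of_int (- int (2 * Suc k) - 1) * slit_pot (- int (2 * Suc (Suc k))) 0 = 0"
    using slit_pot_recurrence[of "- int (2 * Suc k)"] unfolding * Suc by simp
  thus ?case by (simp del: of_nat_Suc) 
qed

text \<open>
  This is where \<open>\<surd>2\<close> enters the generating functions: \<open>kern 0 r = 1 / (1 + r\<^sup>2)\<close> cancels against
  \<open>r\<^sup>y + r\<^sup>y\<^sup>+\<^sup>2\<close>.
\<close>

lemma slit_pot_column_0: "slit_pot 0 y + slit_pot 0 (y + 2) = sqrt 2 * wallis y"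
proof -
  have "slit_pot 0 y + slit_pot 0 (y + 2) = sqrt 2 * arcsine_mean (\<lambda>r. r ^ y * kern 0 r + r ^ (y + 2) * kern 0 r)"
    unfolding slit_pot_def by (simp only: arcsine_mean_add continuous_intros ring_distribs)
  also have "(\<lambda>r. r ^ y * kern 0 r + r ^ (y + 2) * kern 0 r) = (\<lambda>r. r ^ y)"
    by (rule ext) (simp add: kern_0 divide_simps power_add, simp add: algebra_simps power2_eq_square)
  finally show ?thesis by (simp add: wallis_def)
qed

lemma slit_pot_column_minus_1: "slit_pot (- 1) y = slit_pot 0 (Suc y)"
  by (simp add: slit_pot_def kern_0 kern_minus_1 mult.commute)

lemma abs_slit_pot_le: "\<bar>slit_pot x y\<bar> \<le> sqrt 2 * arcsine_mean (\<lambda>r. \<bar>r\<bar> ^ y)"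
proof -
  have "\<bar>arcsine_mean (\<lambda>r. r ^ y * kern x r)\<bar> \<le> arcsine_mean (\<lambda>r. \<bar>r\<bar> ^ y)"
    by (rule arcsine_mean_abs_le)
       (auto intro!: continuous_intros mult_left_le abs_kern_le_1 simp: abs_mult power_abs)
  thus ?thesis by (simp add: slit_pot_def abs_mult)
qed
lemma slit_pot_even_axis: "even x \<Longrightarrow> slit_pot (int x) 0 = wallis x"
  using slit_pot_positive_axis by (auto elim!: evenE)

lemma slit_pot_even_slit:
  assumes "even x" "x > 0"
  shows "slit_pot (- int x) 0 = 0"
proof -
  obtain k where k: "x = 2 * Suc k"
    using assms by (metis evenE gr0_implies_Suc mult_is_0 not_gr0)
  show ?thesis unfolding k by (rule slit_pot_slit)
qed

lemma slit_pot_minus_1_1: "slit_pot (- 1) (Suc 0) = sqrt 2 - 1"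
  using slit_pot_column_0[of 0]
  by (simp add: slit_pot_column_minus_1 slit_pot_origin wallis_0 numeral_2_eq_2)

section \<open>Occupation times by first-step analysis\<close>

abbreviation steps :: "(int \<times> int) set" where
  "steps \<equiv> {(1, 0), (-1, 0), (0, 1), (0, -1)}"

definition site_measure :: "(real \<times> (int \<times> int)) measure" where
  "site_measure = density lborel (\<lambda>t. ennreal (exponential_density 4 t)) \<Otimes>\<^sub>M measure_pmf step_pmf"

lemma walk_measure_eq: "walk_measure = Pi\<^sub>M UNIV (\<lambda>_. site_measure)"
  by (simp add: walk_measure_def site_measure_def)

abbreviation "holding_law \<equiv> density lborel (\<lambda>t. ennreal (exponential_density 4 t))"

interpretation holding_law: prob_space holding_law
  by (rule prob_space_exponential_density) simp

interpretation holding_step: pair_prob_space holding_law "measure_pmf step_pmf" ..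

interpretation site: prob_space site_measure
  unfolding site_measure_def by (rule holding_step.prob_space_axioms)

interpretation walk: sequence_space site_measure ..

lemma AE_site_pos: "AE s in site_measure. fst s > 0"
proof -
  have "AE t in holding_law. t > 0"
    using AE_lborel_singleton[of 0]
    by (subst AE_density) (auto simp: exponential_density_def elim!: eventually_mono split: if_splits)
  hence "AE t in distr site_measure holding_law fst. t > 0"
    unfolding site_measure_def measure_pmf.distr_pair_fst .
  thus ?thesis by (rule AE_distrD[rotated]) (simp add: site_measure_def)
qed

lemma AE_walk_pos: "AE \<omega> in walk_measure. \<forall>n. fst (\<omega> n) > 0"
  unfolding walk_measure_eq AE_all_countable
  by (intro allI AE_PiM_component AE_site_pos site.prob_space_axioms) simp

lemma measurable_holding [measurable]: "(\<lambda>\<omega>. fst (\<omega> n)) \<in> borel_measurable walk_measure"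
  unfolding walk_measure_eq site_measure_def by measurable

lemma measurable_step [measurable]: "(\<lambda>\<omega>. snd (\<omega> n)) \<in> measurable walk_measure (count_space UNIV)"
  unfolding walk_measure_eq site_measure_def by measurable

lemma measurable_jump_chain [measurable]: "(\<lambda>\<omega>. jump_chain u \<omega> n) \<in> measurable walk_measure (count_space UNIV)"
proof (induction n)
  case (Suc n)
  have "(\<lambda>\<omega>. jump_chain u \<omega> n + snd (\<omega> n)) \<in> measurable walk_measure (count_space UNIV)"
    by (rule measurable_compose_countable[OF _ measurable_step, of "\<lambda>e \<omega>. jump_chain u \<omega> n + e"])
       (use Suc in measurable)
  thus ?case by (simp add: jump_chain_def add.assoc)
qed (simp add: jump_chain_def)

definition survives :: "(int \<times> int) set \<Rightarrow> int \<times> int \<Rightarrow> int \<times> int \<Rightarrow> nat \<Rightarrow> (nat \<Rightarrow> real \<times> (int \<times> int)) \<Rightarrow> bool" where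
  "survives B u v n \<omega> \<longleftrightarrow> jump_chain u \<omega> n = v \<and> (\<forall>m\<le>n. jump_chain u \<omega> m \<notin> B)"

lemma measurable_survives [measurable]: "Measurable.pred walk_measure (survives B u v n)"
  unfolding survives_def by measurable

definition occupation :: "(int \<times> int) set \<Rightarrow> int \<times> int \<Rightarrow> int \<times> int \<Rightarrow> nat \<Rightarrow> ennreal" where
  "occupation B u v n = (\<integral>\<^sup>+ \<omega>. (if survives B u v n \<omega> then ennreal (fst (\<omega> n)) else 0) \<partial>walk_measure)"

text \<open>
  Positive holding times make every site of the jump chain visible at its jump time, so
  that avoiding \<open>B\<close> up to time \<open>t\<close> only depends on the jump chain.  Explosion needs no care: times beyond
  the explosion belong to none of the intervals.
\<close>

lemma time_before_hitting_as_suminf: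
  assumes pos: "\<And>n. fst (\<omega> n) > 0"
  shows "time_before_hitting B u v \<omega> = (\<Sum>n. if survives B u v n \<omega> then ennreal (fst (\<omega> n)) else 0)"
proof -
  let ?T = "jump_time \<omega>"
  have mono: "strict_mono ?T"
    by (rule strict_monoI_Suc) (simp add: jump_time_def pos)
  define I where "I n = (if survives B u v n \<omega> then {?T n..<?T (Suc n)} else {})" for n
  have in_I: "walk_at u \<omega> t v \<and> (\<forall>s\<le>t. \<forall>d\<in>B. \<not> walk_at u \<omega> s d) \<longleftrightarrow> (\<exists>n. t \<in> I n)" for t
  proof
    assume t: "walk_at u \<omega> t v \<and> (\<forall>s\<le>t. \<forall>d\<in>B. \<not> walk_at u \<omega> s d)"
    then obtain n where n: "?T n \<le> t" "t < ?T (Suc n)" "jump_chain u \<omega> n = v"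
      by (auto simp: walk_at_def)
    have "jump_chain u \<omega> m \<notin> B" if "m \<le> n" for m
    proof -
      have "?T m \<le> t" using that n(1) mono by (meson order_trans strict_mono_less_eq)
      moreover have "walk_at u \<omega> (?T m) (jump_chain u \<omega> m)"
        unfolding walk_at_def using mono by (intro exI[of _ m]) (auto simp: strict_mono_less)
      ultimately show ?thesis using t by blast
    qed
    thus "\<exists>n. t \<in> I n" using n by (auto simp: I_def survives_def intro!: exI[of _ n])
  next
    assume "\<exists>n. t \<in> I n"
    then obtain n where n: "survives B u v n \<omega>" "?T n \<le> t" "t < ?T (Suc n)"
      by (auto simp: I_def split: if_splits)
    have "\<not> walk_at u \<omega> s d" if s: "s \<le> t" "d \<in> B" for s d
    proof
      assume "walk_at u \<omega> s d"
      then obtain m where m: "?T m \<le> s" "jump_chain u \<omega> m = d" by (auto simp: walk_at_def)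
      have "?T m < ?T (Suc n)" using m s n by linarith
      hence "m \<le> n" using mono by (simp add: strict_mono_less less_Suc_eq_le)
      thus False using n(1) m s by (auto simp: survives_def)
    qed
    thus "walk_at u \<omega> t v \<and> (\<forall>s\<le>t. \<forall>d\<in>B. \<not> walk_at u \<omega> s d)"
      using n by (auto simp: walk_at_def survives_def)
  qed
  have disj: "disjoint_family I"
    unfolding disjoint_family_on_def
  proof (intro ballI impI)
    fix m n :: nat assume "m \<noteq> n"
    hence "Suc m \<le> n \<or> Suc n \<le> m" by linarith
    hence "?T (Suc m) \<le> ?T n \<or> ?T (Suc n) \<le> ?T m" using mono by (simp add: strict_mono_less_eq)
    thus "I m \<inter> I n = {}" by (auto simp: I_def)
  qed
  have "time_before_hitting B u v \<omega> = emeasure lborel (\<Union>n. I n)"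
    unfolding time_before_hitting_def in_I by (intro arg_cong[where f = "emeasure lborel"]) auto
  also have "\<dots> = (\<Sum>n. emeasure lborel (I n))"
    by (rule suminf_emeasure[symmetric]) (auto simp: I_def disj[unfolded I_def])
  also have "(\<lambda>n. emeasure lborel (I n)) = (\<lambda>n. if survives B u v n \<omega> then ennreal (fst (\<omega> n)) else 0)"
    using pos by (intro ext) (auto simp: I_def jump_time_def less_imp_le)
  finally show ?thesis .
qed

lemma nn_integral_time_before_hitting:
  "(\<integral>\<^sup>+ \<omega>. time_before_hitting B u v \<omega> \<partial>walk_measure) = (\<Sum>n. occupation B u v n)"
proof -
  have "(\<integral>\<^sup>+ \<omega>. time_before_hitting B u v \<omega> \<partial>walk_measure)
     = (\<integral>\<^sup>+ \<omega>. (\<Sum>n. if survives B u v n \<omega> then ennreal (fst (\<omega> n)) else 0) \<partial>walk_measure)"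
    by (rule nn_integral_cong_AE) (use AE_walk_pos in eventually_elim, rule time_before_hitting_as_suminf, simp)
  also have "\<dots> = (\<Sum>n. occupation B u v n)"
    unfolding occupation_def by (rule nn_integral_suminf) measurable
  finally show ?thesis .
qed

lemma ennreal_quarter: "ennreal (1 / 4) = 1 / 4"
proof -
  have "ennreal 1 / 4 = ennreal (1 / 4)" by (rule ennreal_divide_numeral) simp
  thus ?thesis by simp
qed

lemma occupation_0: "occupation B u v 0 = (if u = v \<and> u \<notin> B then 1 / 4 else 0)"
proof -
  have "(\<integral>\<^sup>+ \<omega>. ennreal (fst (\<omega> 0)) \<partial>walk_measure)
      = (\<integral>\<^sup>+ s. ennreal (fst s) \<partial>distr walk_measure site_measure (\<lambda>\<omega>. \<omega> 0))"
    unfolding walk_measure_eq by (subst nn_integral_distr) (auto simp: site_measure_def)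
  also have "\<dots> = (\<integral>\<^sup>+ s. ennreal (fst s) \<partial>site_measure)"
    unfolding walk_measure_eq by (subst distr_PiM_component) (auto intro: site.prob_space_axioms)
  also have "\<dots> = (\<integral>\<^sup>+ t. ennreal t \<partial>distr site_measure holding_law fst)"
    by (subst nn_integral_distr) (auto simp: site_measure_def)
  also have "\<dots> = (\<integral>\<^sup>+ t. ennreal t \<partial>holding_law)"
    unfolding site_measure_def measure_pmf.distr_pair_fst ..
  also have "\<dots> = (\<integral>\<^sup>+ t. ennreal (erlang_density 0 4 t * t ^ 1) \<partial>lborel)"
    by (subst nn_integral_density) (auto simp: ennreal_mult' intro!: nn_integral_cong)
  also have "\<dots> = ennreal (1 / 4)"
    by (subst nn_integral_erlang_ith_moment) auto
  finally have holding: "(\<integral>\<^sup>+ \<omega>. ennreal (fst (\<omega> 0)) \<partial>walk_measure) = 1 / 4"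
    by (simp only: ennreal_quarter)
  have "survives B u v 0 \<omega> \<longleftrightarrow> u = v \<and> u \<notin> B" for \<omega>
    by (auto simp: survives_def jump_chain_def)
  note start = this
  show ?thesis
  proof (cases "u = v \<and> u \<notin> B")
    case True
    hence "survives B u v 0 \<omega>" for \<omega> using start by blast
    with True show ?thesis by (auto simp: occupation_def holding)
  next
    case False
    hence "\<not> survives B u v 0 \<omega>" for \<omega> using start by blast
    with False show ?thesis by (auto simp: occupation_def)
  qed
qed

lemma jump_chain_case_nat:
  "jump_chain u (case_nat s \<omega>) (Suc n) = jump_chain (u + snd s) \<omega> n"
  unfolding jump_chain_def by (subst sum.lessThan_Suc_shift) (simp add: add.assoc)

lemma survives_case_nat:
  "survives B u v (Suc n) (case_nat s \<omega>) \<longleftrightarrow> u \<notin> B \<and> survives B (u + snd s) v n \<omega>"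
proof -
  have "(\<forall>m\<le>Suc n. jump_chain u (case_nat s \<omega>) m \<notin> B)
     \<longleftrightarrow> jump_chain u (case_nat s \<omega>) 0 \<notin> B \<and> (\<forall>m\<le>n. jump_chain u (case_nat s \<omega>) (Suc m) \<notin> B)"
    by (metis Suc_le_mono not0_implies_Suc zero_le)
  thus ?thesis unfolding survives_def jump_chain_case_nat by (auto simp: jump_chain_def[of _ _ 0])
qed

text \<open>
  The first coordinate of a sample can be split off, and what remains is again a sample
  (\<open>walk.PiM_iter\<close>).  The holding time at step \<open>Suc n\<close> and the later steps therefore belong to a fresh
  walk started at the second site, and the first holding time integrates out.
\<close>

lemma occupation_Suc:
  "occupation B u v (Suc n) = (if u \<in> B then 0 else (\<Sum>e\<in>steps. occupation B (u + e) v n) / 4)"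
proof -
  define g where "g \<omega> = (if survives B u v (Suc n) \<omega> then ennreal (fst (\<omega> (Suc n))) else 0)" for \<omega>
  have g [measurable]: "g \<in> borel_measurable walk_measure"
    unfolding g_def by measurable
  have gd: "distr (site_measure \<Otimes>\<^sub>M walk_measure) walk_measure (\<lambda>(s, \<omega>). case_nat s \<omega>) = walk_measure"
    unfolding walk_measure_eq by (rule walk.PiM_iter)
  have m: "(\<lambda>(s, \<omega>). case_nat s \<omega>) \<in> measurable (site_measure \<Otimes>\<^sub>M walk_measure) walk_measure"
    unfolding walk_measure_eq by measurable
  interpret W: prob_space walk_measure
    unfolding walk_measure_eq by (rule walk.prob_space_axioms)
  have "occupation B u v (Suc n) = (\<integral>\<^sup>+ \<omega>. g \<omega> \<partial>distr (site_measure \<Otimes>\<^sub>M walk_measure) walk_measure (\<lambda>(s, \<omega>). case_nat s \<omega>))"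
    unfolding gd occupation_def g_def ..
  also have "\<dots> = (\<integral>\<^sup>+ p. g (case_nat (fst p) (snd p)) \<partial>(site_measure \<Otimes>\<^sub>M walk_measure))"
    using m by (subst nn_integral_distr) (auto simp: case_prod_unfold)
  also have "\<dots> = (\<integral>\<^sup>+ s. \<integral>\<^sup>+ \<omega>. g (case_nat s \<omega>) \<partial>walk_measure \<partial>site_measure)"
    using measurable_compose[OF m g]
    by (subst W.nn_integral_fst[symmetric]) (auto simp: case_prod_unfold)
  also have "\<dots> = (\<integral>\<^sup>+ s. (if u \<in> B then 0 else occupation B (u + snd s) v n) \<partial>site_measure)"
  proof (rule nn_integral_cong)
    fix s
    have "g (case_nat s \<omega>)
        = (if u \<in> B then 0 else if survives B (u + snd s) v n \<omega> then ennreal (fst (\<omega> n)) else 0)" for \<omega>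
      unfolding g_def survives_case_nat nat.case by auto
    thus "(\<integral>\<^sup>+ \<omega>. g (case_nat s \<omega>) \<partial>walk_measure) = (if u \<in> B then 0 else occupation B (u + snd s) v n)"
      by (simp add: occupation_def)
  qed
  also have "\<dots> = (\<integral>\<^sup>+ t. \<integral>\<^sup>+ e. (if u \<in> B then 0 else occupation B (u + e) v n) \<partial>measure_pmf step_pmf \<partial>holding_law)"
  proof -
    have "(\<lambda>s. if u \<in> B then 0 else occupation B (u + snd s) v n)
        \<in> borel_measurable (holding_law \<Otimes>\<^sub>M measure_pmf step_pmf)" by measurable
    from measure_pmf.nn_integral_fst[OF this] show ?thesis
      by (simp only: site_measure_def snd_conv)
  qed
  also have "\<dots> = (\<integral>\<^sup>+ e. (if u \<in> B then 0 else occupation B (u + e) v n) \<partial>measure_pmf step_pmf)"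
    using holding_law.emeasure_space_1 by simp
  also have "\<dots> = (\<Sum>e\<in>steps. (if u \<in> B then 0 else occupation B (u + e) v n)) / 4"
    unfolding step_pmf_def by (subst nn_integral_pmf_of_set) auto
  finally show ?thesis by auto
qed

section \<open>The killed averaging operator\<close>

definition killed_avg :: "(int \<times> int) set \<Rightarrow> (int \<times> int \<Rightarrow> real) \<Rightarrow> int \<times> int \<Rightarrow> real" where
  "killed_avg B f u = (if u \<in> B then 0 else (\<Sum>e\<in>steps. f (u + e)) / 4)"

definition point_mass :: "(int \<times> int) set \<Rightarrow> int \<times> int \<Rightarrow> int \<times> int \<Rightarrow> real" where
  "point_mass B v u = (if u = v \<and> v \<notin> B then 1 / 4 else 0)"

abbreviation killed_iter :: "(int \<times> int) set \<Rightarrow> nat \<Rightarrow> (int \<times> int \<Rightarrow> real) \<Rightarrow> int \<times> int \<Rightarrow> real" where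
  "killed_iter B n \<equiv> killed_avg B ^^ n"

lemma killed_iter_nonneg: "(\<And>u. f u \<ge> 0) \<Longrightarrow> killed_iter B n f u \<ge> 0"
  by (induction n arbitrary: u) (auto simp: killed_avg_def)

lemma occupation_eq: "occupation B u v n = ennreal (killed_iter B n (point_mass B v) u)"
proof (induction n arbitrary: u)
  case 0
  show ?case by (auto simp: occupation_0 point_mass_def ennreal_quarter)
next
  case (Suc n)
  define k where "k = killed_iter B n (point_mass B v)"
  have nn: "k u \<ge> 0" for u
    unfolding k_def by (rule killed_iter_nonneg) (simp add: point_mass_def)
  have "occupation B u v (Suc n) = ennreal (killed_avg B k u)"
    unfolding occupation_Suc Suc k_def[symmetric]
    by (simp add: killed_avg_def nn sum_nonneg ennreal_divide_numeral flip: ennreal_plus)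
  thus ?case by (simp add: k_def)
qed

text \<open>
  Last-step analysis, obtained from first-step analysis by induction: the sums over the first and
  over the last step are interchanged.
\<close>

lemma killed_iter_point_mass_target:
  "killed_iter B (Suc n) (point_mass B v) u
     = (if v \<in> B then 0 else (\<Sum>e\<in>steps. killed_iter B n (point_mass B (v + e)) u) / 4)"
proof (induction n arbitrary: u)
  case 0
  show ?case by (cases u; cases v) (auto simp: killed_avg_def point_mass_def)
next
  case (Suc n)
  have "killed_iter B (Suc (Suc n)) (point_mass B v) u
      = killed_avg B (\<lambda>u. killed_iter B (Suc n) (point_mass B v) u) u" by simp
  also have "\<dots> = (if v \<in> B then 0 else (\<Sum>e\<in>steps. killed_iter B (Suc n) (point_mass B (v + e)) u) / 4)"
    unfolding Suc by (simp add: killed_avg_def add_divide_distrib)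
  finally show ?case .
qed

text \<open>
  Reversal of paths.  It is needed because the walk starts at the origin, whereas the Poisson
  equation describes the dependence on the starting point.
\<close>

lemma killed_iter_point_mass_sym:
  "killed_iter B n (point_mass B v) u = killed_iter B n (point_mass B u) v"
proof (induction n arbitrary: u)
  case 0
  show ?case by (auto simp: point_mass_def)
next
  case (Suc n)
  have "killed_iter B (Suc n) (point_mass B v) u
      = (if u \<in> B then 0 else (\<Sum>e\<in>steps. killed_iter B n (point_mass B v) (u + e)) / 4)"
    by (simp add: killed_avg_def)
  also have "\<dots> = killed_iter B (Suc n) (point_mass B u) v"
    unfolding killed_iter_point_mass_target Suc ..
  finally show ?case .
qed

lemma killed_avg_add: "killed_avg B (\<lambda>u. f u + g u) = (\<lambda>u. killed_avg B f u + killed_avg B g u)"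
  by (rule ext) (simp add: killed_avg_def sum.distrib add_divide_distrib)

lemma killed_iter_add: "killed_iter B n (\<lambda>u. f u + g u) = (\<lambda>u. killed_iter B n f u + killed_iter B n g u)"
  by (induction n) (simp_all add: killed_avg_add)

text \<open>
  Iterating the Poisson equation \<open>n\<close> times gives the partial sum of the Neumann series plus the
  remainder \<open>Q\<^sup>n h\<close>.
\<close>

theorem dirichlet_green_eqI:
  assumes h: "\<And>u. h u = killed_avg B h u + point_mass B w u"
    and decay: "\<And>u. (\<lambda>n. killed_iter B n h u) \<longlonglongrightarrow> 0"
  shows "dirichlet_green B w v = h v"
proof -
  have partial: "h v = (\<Sum>k<n. killed_iter B k (point_mass B w) v) + killed_iter B n h v" for n
  proof (induction n)
    case (Suc n)
    have "h = (\<lambda>u. killed_avg B h u + point_mass B w u)" using h by (rule ext)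
    hence "killed_iter B n h = killed_iter B n (\<lambda>u. killed_avg B h u + point_mass B w u)"
      by (rule arg_cong)
    also have "\<dots> = (\<lambda>u. killed_iter B (Suc n) h u + killed_iter B n (point_mass B w) u)"
      unfolding killed_iter_add by (simp add: funpow_swap1)
    finally have "killed_iter B n h v = killed_iter B (Suc n) h v + killed_iter B n (point_mass B w) v"
      by (rule fun_cong)
    thus ?case using Suc unfolding sum.lessThan_Suc by linarith
  qed simp
  have "(\<lambda>n. h v - killed_iter B n h v) \<longlonglongrightarrow> h v - 0"
    by (intro tendsto_intros decay)
  moreover have "h v - killed_iter B n h v = (\<Sum>k<n. killed_iter B k (point_mass B w) v)" for n
    using partial[of n] by simp
  ultimately have "(\<lambda>n. killed_iter B n (point_mass B w) v) sums h v"
    by (simp add: sums_def)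
  hence sums: "(\<lambda>n. killed_iter B n (point_mass B v) w) sums h v"
    by (simp add: killed_iter_point_mass_sym[of _ B v w])
  have nn: "killed_iter B n (point_mass B v) w \<ge> 0" for n
    by (rule killed_iter_nonneg) (simp add: point_mass_def)
  have "h v \<ge> 0" using sums nn by (metis sums_unique suminf_nonneg sums_summable)
  moreover have "(\<Sum>n. occupation B w v n) = ennreal (h v)"
    unfolding occupation_eq by (rule suminf_ennreal_eq[OF nn sums])
  ultimately show ?thesis
    by (simp add: dirichlet_green_def nn_integral_time_before_hitting)
qed

text \<open>
  The probability that simple random walk on the integers is displaced by \<open>d\<close> after \<open>n\<close> steps, written as the
  Fourier inversion integral.
\<close>

definition srw_prob :: "nat \<Rightarrow> int \<Rightarrow> real" where
  "srw_prob n d = integral {0..pi} (\<lambda>t. cos t ^ n * cos (of_int d * t)) / pi"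

lemma srw_prob_0: "srw_prob 0 d = (if d = 0 then 1 else 0)"
proof (cases "d = 0")
  case False
  have "((\<lambda>t. cos (of_int d * t)) has_integral (sin (of_int d * pi) / of_int d - sin (of_int d * 0) / of_int d)) {0..pi}"
    using False
    by (intro fundamental_theorem_of_calculus)
       (auto intro!: derivative_eq_intros simp: has_real_derivative_iff_has_vector_derivative[symmetric])
  moreover have "sin (of_int d * pi) = 0" by (simp add: sin_zero_iff_int2)
  ultimately show ?thesis using False by (simp add: srw_prob_def integral_unique)
qed (simp add: srw_prob_def)

lemma srw_prob_Suc: "srw_prob (Suc n) d = (srw_prob n (d + 1) + srw_prob n (d - 1)) / 2"
proof -
  have "integral {0..pi} (\<lambda>t. cos t ^ n * cos (of_int (d + 1) * t)) + integral {0..pi} (\<lambda>t. cos t ^ n * cos (of_int (d - 1) * t))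
    = integral {0..pi} (\<lambda>t. cos t ^ n * cos (of_int (d + 1) * t) + cos t ^ n * cos (of_int (d - 1) * t))"
    by (rule integral_add[symmetric]) (intro integrable_continuous_real continuous_intros)+
  also have "(\<lambda>t::real. cos t ^ n * cos (of_int (d + 1) * t) + cos t ^ n * cos (of_int (d - 1) * t))
     = (\<lambda>t. 2 * (cos t ^ Suc n * cos (of_int d * t)))"
    by (rule ext) (simp add: algebra_simps cos_add cos_diff)
  finally show ?thesis by (simp add: srw_prob_def divide_simps)
qed

lemma abs_srw_prob_le: "\<bar>srw_prob n d\<bar> \<le> arcsine_mean (\<lambda>r. \<bar>r\<bar> ^ n)"
proof -
  have "norm (integral {0..pi} (\<lambda>t. cos t ^ n * cos (of_int d * t))) \<le> integral {0..pi} (\<lambda>t. \<bar>cos t\<bar> ^ n)"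
    by (rule integral_norm_bound_integral)
       (auto intro!: integrable_continuous_real continuous_intros mult_left_le simp: abs_mult power_abs)
  thus ?thesis by (simp add: srw_prob_def arcsine_mean_def divide_right_mono)
qed

text \<open>
  Killing only decreases averages of \<open>\<bar>f\<bar>\<close>, and \<open>b - a\<close> performs a simple random walk.  Outside a finite set
  \<open>J\<close> of values of \<open>b - a\<close> the bound \<open>F\<close> is below \<open>\<epsilon> / 2\<close>, and the probability of being in \<open>J\<close> tends to \<open>0\<close>.
\<close>

lemma killed_iter_tendsto_0:
  assumes f: "\<And>u. \<bar>f u\<bar> \<le> F (nat \<bar>snd u - fst u\<bar>)" and bound: "\<And>y. F y \<le> C" and F: "F \<longlonglongrightarrow> 0"
  shows "(\<lambda>n. killed_iter B n f u) \<longlonglongrightarrow> 0"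
proof (rule LIMSEQ_I)
  fix \<epsilon> :: real assume "\<epsilon> > 0"
  have "0 \<le> F 0" using f[of "(0, 0)"] by simp
  hence C: "C \<ge> 0" using bound[of 0] by simp
  obtain Y where Y: "\<And>y. y \<ge> Y \<Longrightarrow> \<bar>F y\<bar> < \<epsilon> / 2"
    using LIMSEQ_D[OF F, of "\<epsilon> / 2"] \<open>\<epsilon> > 0\<close> by auto
  define J where "J = {- int Y..int Y}"
  have finJ: "finite J" by (simp add: J_def)
  (* G n is the image under n averaging steps of eps / 2 + C * indicator of J, which dominates F. *)
  define G where "G n y = \<epsilon> / 2 + C * (\<Sum>j\<in>J. srw_prob n (y - j))" for n y
  have G_Suc: "G (Suc n) y = (G n (y + 1) + G n (y - 1)) / 2" for n y
    by (simp add: G_def srw_prob_Suc sum.distrib algebra_simps sum_divide_distrib[symmetric] add_divide_distrib)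
  have le: "\<bar>killed_iter B n f u\<bar> \<le> G n (snd u - fst u)" for n u
  proof (induction n arbitrary: u)
    case 0
    have G0: "G 0 y = \<epsilon> / 2 + (if y \<in> J then C else 0)" for y
      using finJ by (simp add: G_def srw_prob_0 sum.delta' cong: if_cong)
    show ?case
    proof (cases "snd u - fst u \<in> J")
      case True
      have "\<bar>f u\<bar> \<le> C" using f[of u] bound order_trans by blast
      thus ?thesis using True \<open>\<epsilon> > 0\<close> by (simp add: G0)
    next
      case False
      hence "nat \<bar>snd u - fst u\<bar> \<ge> Y" by (auto simp: J_def)
      from Y[OF this] f[of u] show ?thesis using False by (simp add: G0)
    qed
  next
    case (Suc n)
    obtain a b where u: "u = (a, b)" by (cases u)
    show ?case
    proof (cases "u \<in> B")
      case True
      have "0 \<le> (G n (snd u - fst u + 1) + G n (snd u - fst u - 1)) / 2"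
        using Suc[of "(a, b + 1)"] Suc[of "(a, b - 1)"] by (simp add: u algebra_simps)
      thus ?thesis using True by (simp add: killed_avg_def G_Suc)
    next
      case False
      have "\<bar>killed_iter B (Suc n) f u\<bar> = \<bar>\<Sum>e\<in>steps. killed_iter B n f (u + e)\<bar> / 4"
        using False by (simp add: killed_avg_def)
      also have "\<dots> \<le> (\<Sum>e\<in>steps. \<bar>killed_iter B n f (u + e)\<bar>) / 4"
        by (intro divide_right_mono sum_abs) simp
      also have "\<dots> \<le> (\<Sum>e\<in>steps. G n (snd (u + e) - fst (u + e))) / 4"
        by (intro divide_right_mono sum_mono Suc) simp
      also have "\<dots> = G (Suc n) (snd u - fst u)"
        by (simp add: u G_Suc algebra_simps)
      finally show ?thesis .
    qed
  qed
  have "(\<lambda>n. G n (snd u - fst u)) \<longlonglongrightarrow> \<epsilon> / 2 + C * (\<Sum>j\<in>J. 0)"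
    unfolding G_def
    by (intro tendsto_intros Lim_null_comparison[OF _ arcsine_mean_abs_power_tendsto_0])
       (auto intro!: always_eventually abs_srw_prob_le)
  hence "eventually (\<lambda>n. G n (snd u - fst u) < \<epsilon>) sequentially"
    by (rule order_tendstoD(2)) (use \<open>\<epsilon> > 0\<close> in simp)
  then obtain N where "\<And>n. n \<ge> N \<Longrightarrow> G n (snd u - fst u) < \<epsilon>"
    by (auto simp: eventually_sequentially)
  thus "\<exists>N. \<forall>n\<ge>N. norm (killed_iter B n f u - 0) < \<epsilon>"
    using le_less_trans[OF le, of _ u] by (auto simp del: split_paired_All split_paired_all)
qed
section \<open>Identification of the Green's function\<close>

definition slit_green :: "int \<times> int \<Rightarrow> real" where
  "slit_green u = slit_pot (fst u + snd u) (nat \<bar>snd u - fst u\<bar>) / 2"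

text \<open>
  For \<open>m = 2 a \<ge> 0\<close> the Laplacian at \<open>(a, a)\<close> is \<open>H(- m, 0) - H(- m - 2, 0)\<close>, a difference of values on the slit
  unless \<open>m = 0\<close>, where the first one is the value \<open>1\<close> at the origin.
\<close>

lemma slit_green_diagonal:
  "slit_green (a, a) = killed_avg slit slit_green (a, a) + point_mass slit (0, 0) (a, a)"
proof (cases "a \<le> - 1")
  case True
  define m where "m = nat (- 2 * a)"
  have m: "even m" "m > 0" "2 * a = - int m" using True by (auto simp: m_def even_nat_iff)
  have "slit_green (a, a) = slit_pot (- int m) 0 / 2"
    by (simp add: slit_green_def flip: m(3))
  also have "\<dots> = 0" using slit_pot_even_slit[OF m(1,2)] by simp
  finally show ?thesis using True by (simp add: killed_avg_def point_mass_def slit_def)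
next
  case False
  define m where "m = nat (2 * a)"
  have m: "even m" "2 * a = int m" using False by (auto simp: m_def even_nat_iff)
  have source: "slit_pot (- int m) 0 - slit_pot (- int m - 2) 0 = (if a = 0 then 1 else 0)"
  proof -
    have *: "- int m - 2 = - int (m + 2)" by simp
    have "slit_pot (- int (m + 2)) 0 = 0" by (rule slit_pot_even_slit) (use m in auto)
    moreover have "slit_pot (- int m) 0 = (if a = 0 then 1 else 0)"
      using m slit_pot_even_slit[of m] slit_pot_origin by (cases "m = 0") auto
    ultimately show ?thesis unfolding * by simp
  qed
  have nbrs: "(\<Sum>e\<in>steps. slit_green ((a, a) + e)) = slit_pot (int m + 1) 1 + slit_pot (int m - 1) 1"
    by (simp add: slit_green_def m(2)[symmetric] algebra_simps)
  have here: "slit_green (a, a) = slit_pot (int m) 0 / 2"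
    by (simp add: slit_green_def m(2)[symmetric])
  have avg: "killed_avg slit slit_green (a, a) = (\<Sum>e\<in>steps. slit_green ((a, a) + e)) / 4"
    using False unfolding killed_avg_def by (auto simp only: slit_def split: if_splits)
  have mass: "point_mass slit (0, 0) (a, a) = (if a = 0 then 1 / 4 else 0)"
    by (simp add: point_mass_def slit_def)
  have "p / 2 = (q + s) / 4 + (if a = 0 then 1 / 4 else 0)"
    if "4 * p - 2 * q - 2 * s = 2 * (if a = 0 then 1 else 0)" for p q s :: real
    using that by (cases "a = 0") (auto simp: field_simps)
  from this[OF slit_pot_axis[of "int m", unfolded source]] show ?thesis
    unfolding avg nbrs here mass .
qed

lemma slit_green_poisson:
  "slit_green u = killed_avg slit slit_green u + point_mass slit (0, 0) u"
proof -
  obtain a b where u: "u = (a, b)" by (cases u)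
  show ?thesis
  proof (cases "a = b")
    case True
    thus ?thesis using slit_green_diagonal[of a] u by simp
  next
    case False
    define y where "y = nat (\<bar>b - a\<bar> - 1)"
    have y: "nat \<bar>b - a\<bar> = Suc y" "\<bar>b - a\<bar> = int y + 1" using False by (auto simp: y_def)
    have "slit_green (a, b) = slit_pot (a + b) (Suc y) / 2"
      by (simp add: slit_green_def y(1))
    also have "\<dots> = (slit_pot (a + b + 1) (Suc (Suc y)) + slit_pot (a + b - 1) (Suc (Suc y))
        + slit_pot (a + b + 1) y + slit_pot (a + b - 1) y) / 8"
      unfolding slit_pot_harmonic by simp
    also have "\<dots> = (\<Sum>e\<in>steps. slit_green ((a, b) + e)) / 4"
    proof (cases "a < b")
      case True
      hence "nat \<bar>b - (a + 1)\<bar> = y" "nat \<bar>b - (a - 1)\<bar> = Suc (Suc y)"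
        "nat \<bar>b + 1 - a\<bar> = Suc (Suc y)" "nat \<bar>b - 1 - a\<bar> = y"
        using y by auto
      thus ?thesis by (simp add: slit_green_def algebra_simps)
    next
      case not_less: False
      hence "nat \<bar>b - (a + 1)\<bar> = Suc (Suc y)" "nat \<bar>b - (a - 1)\<bar> = y"
        "nat \<bar>b + 1 - a\<bar> = y" "nat \<bar>b - 1 - a\<bar> = Suc (Suc y)"
        using y False by auto
      thus ?thesis by (simp add: slit_green_def algebra_simps)
    qed
    finally show ?thesis using False u by (auto simp: killed_avg_def point_mass_def slit_def)
  qed
qed

lemma dirichlet_green_slit: "dirichlet_green slit (0, 0) v = slit_green v"
proof (rule dirichlet_green_eqI[OF slit_green_poisson])
  fix u
  define F where "F y = sqrt 2 / 2 * arcsine_mean (\<lambda>r. \<bar>r\<bar> ^ y)" for y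
  have "(\<lambda>n. sqrt 2 / 2 * arcsine_mean (\<lambda>r. \<bar>r\<bar> ^ n)) \<longlonglongrightarrow> sqrt 2 / 2 * 0"
    by (intro tendsto_intros arcsine_mean_abs_power_tendsto_0)
  hence F: "F \<longlonglongrightarrow> 0" by (simp add: F_def[abs_def])
  then obtain C where C: "\<And>y. F y \<le> C"
    using convergent_imp_Bseq[OF convergentI] by (metis BseqE abs_le_D1 real_norm_def)
  show "(\<lambda>n. killed_iter slit n slit_green u) \<longlonglongrightarrow> 0"
  proof (rule killed_iter_tendsto_0[OF _ C F])
    fix u
    show "\<bar>slit_green u\<bar> \<le> F (nat \<bar>snd u - fst u\<bar>)"
      using abs_slit_pot_le[of "fst u + snd u" "nat \<bar>snd u - fst u\<bar>"]
      by (simp add: slit_green_def F_def)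
  qed
qed

lemma G_H_eq_slit_pot:
  assumes "even (x + int y)"
  shows "G_H x (int y) = slit_pot x y"
proof -
  obtain k where k: "x + int y = 2 * k" using assms by (elim evenE)
  hence "(x + int y) div 2 = k" "(x - int y) div 2 = k - int y" by auto
  moreover have "k - int y + k = x" using k by linarith
  ultimately show ?thesis
    unfolding G_H_def dirichlet_green_slit by (simp add: slit_green_def)
qed

section \<open>Series in two variables\<close>

definition wallis_series :: "real fps" where "wallis_series = Abs_fps wallis"

text \<open>
  The recurrence of \<open>wallis\<close> is the differential equation \<open>(1 - X\<^sup>2) A' = X A\<close>, so \<open>A\<^sup>2 (1 - X\<^sup>2)\<close> has derivative
  \<open>0\<close>.
\<close>

lemma wallis_square: "wallis_series ^ 2 * (1 - fps_X ^ 2) = 1"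
proof -
  define A where "A = wallis_series"
  have ode: "fps_deriv A * (1 - fps_X ^ 2) = fps_X * A"
  proof (rule fps_ext)
    fix n
    consider "n = 0" | "n = 1" | m where "n = Suc (Suc m)" by (metis One_nat_def not0_implies_Suc)
    thus "fps_nth (fps_deriv A * (1 - fps_X ^ 2)) n = fps_nth (fps_X * A) n"
    proof cases
      case 1
      thus ?thesis by (simp add: A_def wallis_series_def ring_distribs fps_X_power_mult_right_nth wallis_Suc_0)
    next
      case 2
      thus ?thesis using wallis_recurrence[of 0]
        by (simp add: A_def wallis_series_def ring_distribs fps_X_power_mult_right_nth wallis_0)
    next
      case 3
      thus ?thesis using wallis_recurrence[of "Suc m"]
        by (simp add: A_def wallis_series_def ring_distribs fps_X_power_mult_right_nth algebra_simps)
    qed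
  qed
  have "fps_deriv (A ^ 2 * (1 - fps_X ^ 2)) = 2 * A * (fps_deriv A * (1 - fps_X ^ 2) - fps_X * A)"
    by (simp add: power2_eq_square algebra_simps)
  also have "\<dots> = 0" unfolding ode by simp
  finally have "A ^ 2 * (1 - fps_X ^ 2) = fps_const (fps_nth (A ^ 2 * (1 - fps_X ^ 2)) 0)"
    by (simp only: fps_deriv_eq_0_iff)
  also have "\<dots> = 1" by (simp add: A_def wallis_series_def wallis_0 power2_eq_square)
  finally show ?thesis by (simp add: A_def)
qed

text \<open>
  The coefficient ring \<open>real fps\<close> is not a field, so a series in the second variable is invertible only
  if its constant coefficient is itself an invertible series.
\<close>

lemma fps2_divide_eqI:
  fixes F G H :: "real fps fps"
  assumes "F * G = H" "fps_nth (fps_nth G 0) 0 \<noteq> 0"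
  shows "H / G = F"
proof -
  have G0: "fps_nth G 0 \<noteq> 0" using assms(2) by auto
  have "fps_nth G 0 * inverse (fps_nth G 0) = 1"
    using assms(2) by (rule inverse_mult_eq_1')
  hence "G * inverse G = 1"
    unfolding fps_inverse_def by (rule fps_right_inverse)
  thus ?thesis
    using assms(1) G0 by (auto simp: fps_divide_unit mult.assoc)
qed

lemma fps2_sqrt_eqI:
  assumes "S ^ 2 = F" "fps_nth (fps_nth S 0) 0 = 1"
  shows "fps2_sqrt F = S"
  unfolding fps2_sqrt_def
proof (rule the_equality)
  fix T assume T: "T ^ 2 = F \<and> fps_nth (fps_nth T 0) 0 = 1"
  hence "T = S \<or> T = - S" using assms by (metis power2_eq_iff)
  thus "T = S" using T assms(2) by auto
qed (use assms in simp)

text \<open>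
  The series \<open>(1 - z\<^sup>2)\<^sup>-\<^sup>1\<^sup>/\<^sup>2\<close> in the first and \<open>(1 - w\<^sup>2)\<^sup>-\<^sup>1\<^sup>/\<^sup>2\<close> in the second variable.
\<close>

definition wallis1 :: "real fps fps" where "wallis1 = fps_const wallis_series"
definition wallis2 :: "real fps fps" where "wallis2 = Abs_fps (\<lambda>n. fps_const (wallis n))"

lemma wallis1_square: "wallis1 ^ 2 * (1 - fps2_var1 ^ 2) = 1"
proof -
  have "wallis1 ^ 2 * (1 - fps2_var1 ^ 2) = fps_const (wallis_series ^ 2 * (1 - fps_X ^ 2))"
    unfolding wallis1_def fps2_var1_def
    by (simp del: fps_const_mult fps_const_sub fps_const_power
       add: fps_const_mult[symmetric] fps_const_sub[symmetric] fps_const_power[symmetric])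
  thus ?thesis by (simp add: wallis_square)
qed

lemma wallis2_square: "wallis2 ^ 2 * (1 - fps2_var2 ^ 2) = 1"
proof (rule fps_ext)
  fix n
  have const_sum: "(\<Sum>i\<in>I. fps_const (f i)) = fps_const (\<Sum>i\<in>I. f i)" for f :: "nat \<Rightarrow> real" and I
    by (rule fps_ext) (simp add: fps_sum_nth)
  have sq: "fps_nth (wallis2 ^ 2) k = fps_const (fps_nth (wallis_series ^ 2) k)" for k
    by (simp add: wallis2_def wallis_series_def power2_eq_square fps_mult_nth const_sum)
  have "fps_nth (wallis2 ^ 2 * (1 - fps2_var2 ^ 2)) n = fps_const (fps_nth (wallis_series ^ 2 * (1 - fps_X ^ 2)) n)"
    unfolding fps2_var2_def
    by (simp only: right_diff_distrib mult_1_right fps_sub_nth fps_X_power_mult_right_nth sq) simp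
  thus "fps_nth (wallis2 ^ 2 * (1 - fps2_var2 ^ 2)) n = fps_nth 1 n"
    by (simp add: wallis_square)
qed

lemma fps2_sqrt_wallis:
  assumes "A ^ 2 * (1 - v ^ 2) = 1" "fps_nth (fps_nth A 0) 0 = 1" "fps_nth (fps_nth v 0) 0 = 0"
  shows "fps2_sqrt (1 - v ^ 2) = A * (1 - v ^ 2)" "G / fps2_sqrt (1 - v ^ 2) = G * A"
proof -
  have v: "fps_nth (fps_nth (A * (1 - v ^ 2)) 0) 0 = 1" using assms(2,3) by (simp add: power2_eq_square)
  have "(A * (1 - v ^ 2)) ^ 2 = A ^ 2 * (1 - v ^ 2) * (1 - v ^ 2)"
    by (simp add: power2_eq_square algebra_simps)
  also have "\<dots> = 1 - v ^ 2" unfolding assms(1) by simp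
  finally show *: "fps2_sqrt (1 - v ^ 2) = A * (1 - v ^ 2)"
    using v by (rule fps2_sqrt_eqI)
  have "G * A * (A * (1 - v ^ 2)) = G * (A ^ 2 * (1 - v ^ 2))"
    by (simp add: power2_eq_square mult_ac)
  also have "\<dots> = G" unfolding assms(1) by simp
  finally show "G / fps2_sqrt (1 - v ^ 2) = G * A"
    unfolding * using v by (intro fps2_divide_eqI) auto
qed

definition coef2 :: "real fps fps \<Rightarrow> nat \<Rightarrow> nat \<Rightarrow> real" where
  "coef2 F i j = fps_nth (fps_nth F j) i"

lemma fps2_eqI: "(\<And>i j. coef2 F i j = coef2 G i j) \<Longrightarrow> F = G"
  unfolding coef2_def by (intro fps_ext) auto

lemma coef2_simps [simp]:
  "coef2 (F + G) i j = coef2 F i j + coef2 G i j"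
  "coef2 (F - G) i j = coef2 F i j - coef2 G i j"
  "coef2 (fps2_var1 * F) i j = (if i = 0 then 0 else coef2 F (i - 1) j)"
  "coef2 (fps2_var2 * F) i j = (if j = 0 then 0 else coef2 F i (j - 1))"
  "coef2 (fps2_const c * F) i j = c * coef2 F i j"
  "coef2 (numeral m * F) i j = numeral m * coef2 F i j"
  "coef2 (fps2 a) i j = a i j"
  by (simp_all add: coef2_def fps2_var1_def fps2_var2_def fps2_const_def fps2_def numeral_fps_const)

lemma coef2_wallis1: "coef2 wallis1 i j = (if j = 0 then wallis i else 0)"
  by (simp add: coef2_def wallis1_def wallis_series_def)

lemma coef2_wallis2: "coef2 wallis2 i j = (if i = 0 then wallis j else 0)"
  by (simp add: coef2_def wallis2_def)

lemma nat_012_cases: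
  obtains "n = 0" | "n = Suc 0" | m where "n = Suc (Suc m)"
  by (metis not0_implies_Suc)

text \<open>
  The coefficient of \<open>z\<^sup>i w\<^sup>j\<close> collects the Laplacian at \<open>(i - 1, j - 1)\<close> with the neighbours outside the
  quadrant left out.  It vanishes for \<open>i, j \<ge> 2\<close>.  For \<open>i \<le> 1\<close> and \<open>j \<ge> 2\<close> harmonicity turns the partial
  Laplacian into a sum of two values in column \<open>0\<close> or \<open>- 1\<close>.  For \<open>j \<le> 1\<close> the point lies in the row \<open>- 1\<close> or \<open>0\<close>,
  and what remains are values on the axis, apart from the corner.
\<close>

lemma positive_quadrant_coefficients:
  assumes a: "a = (\<lambda>x y. if even (x + y) then slit_pot (int x) y else 0)"
  shows "4 * (if i = 0 \<or> j = 0 then 0 else a (i - 1) (j - 1)) - (if j < 2 then 0 else a i (j - 2))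
      - (if i < 2 then 0 else a (i - 2) j) - (if i < 2 \<or> j < 2 then 0 else a (i - 2) (j - 2)) - a i j
    = (if i = 1 \<and> j > 0 then sqrt 2 * wallis (j - 1) else 0) - (if i = 0 \<and> j \<ge> 2 then sqrt 2 * wallis (j - 2) else 0)
      + (if i > 0 \<and> j = 1 then 2 * wallis (i - 1) else 0) - (if i \<ge> 2 \<and> j = 0 then wallis (i - 2) else 0)
      - (if j = 0 then wallis i else 0)"
proof -
  have axis: "a x 0 = wallis x" for x
    by (cases "even x") (auto simp: a slit_pot_even_axis wallis_odd)
  have odd0: "odd (x + y) \<Longrightarrow> a x y = 0" for x y by (simp add: a)
  have interior: "a (Suc (Suc x)) (Suc (Suc y)) + a x (Suc (Suc y)) + a (Suc (Suc x)) y + a x y = 4 * a (Suc x) (Suc y)" for x y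
    using slit_pot_harmonic[of "int (Suc x)" y] by (simp add: a add.commute)
  have column_0: "a 0 y + a 0 (Suc (Suc y)) = sqrt 2 * wallis y" for y
    using slit_pot_column_0[of y] by (simp add: a wallis_odd)
  have column_1: "4 * a 0 (Suc y) - a 1 (Suc (Suc y)) - a 1 y = sqrt 2 * wallis (Suc y)" for y
    using slit_pot_harmonic[of 0 y] slit_pot_column_0[of "Suc y"]
    by (simp add: a wallis_odd slit_pot_column_minus_1)
  have row_1: "4 * a (Suc x) 0 - a x 1 - a (Suc (Suc x)) 1 = 2 * wallis (Suc x)" for x
  proof (cases "even x")
    case False
    thus ?thesis
      using slit_pot_axis[of "int (Suc x)"] slit_pot_even_slit[of "Suc x"] slit_pot_even_slit[of "Suc (Suc (Suc x))"]
        slit_pot_even_axis[of "Suc x"]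
      by (simp add: a add.commute)
  qed (simp add: a wallis_odd)
  have corner: "4 * a 0 0 - a 1 1 = sqrt 2 + 2"
    using slit_pot_axis[of 0] slit_pot_slit[of 0] slit_pot_minus_1_1 slit_pot_origin by (simp add: a)
  show ?thesis
  proof (cases j rule: nat_012_cases)
    case 1
    thus ?thesis by (cases i rule: nat_012_cases) (simp_all add: axis)
  next
    case 2
    thus ?thesis using corner row_1 odd0[of 0 1]
      by (cases i rule: nat_012_cases) (simp_all add: axis wallis_0)
  next
    case (3 m)
    thus ?thesis using column_0[of m] column_1[of m]
    proof (cases i rule: nat_012_cases)
      case (3 k)
      thus ?thesis using interior[of k m] \<open>j = Suc (Suc m)\<close> by simp
    qed simp_all
  qed
qed

lemma positive_quadrant:
  fixes z w :: "real fps fps"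
  defines "z \<equiv> fps2_var1" and "w \<equiv> fps2_var2"
  shows "fps2 (\<lambda>x y. if even (x + y) then slit_pot (int x) y else 0)
           * (4 * z * w - w ^ 2 - z ^ 2 - z ^ 2 * w ^ 2 - 1)
         = fps2_const (sqrt 2) * (z * w - w ^ 2) * wallis2 + (2 * z * w - z ^ 2 - 1) * wallis1"
proof (rule fps2_eqI)
  fix i j
  define a where "a = (\<lambda>x y. if even (x + y) then slit_pot (int x) y else 0)"
  have "fps2 a * (4 * z * w - w ^ 2 - z ^ 2 - z ^ 2 * w ^ 2 - 1)
      = 4 * (z * (w * fps2 a)) - w * (w * fps2 a) - z * (z * fps2 a) - z * (z * (w * (w * fps2 a))) - fps2 a"
    by (simp only: right_diff_distrib power2_eq_square mult_1_right) (simp only: mult_ac)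
  moreover have "fps2_const (sqrt 2) * (z * w - w ^ 2) * wallis2 + (2 * z * w - z ^ 2 - 1) * wallis1
      = fps2_const (sqrt 2) * (z * (w * wallis2)) - fps2_const (sqrt 2) * (w * (w * wallis2))
       + 2 * (z * (w * wallis1)) - z * (z * wallis1) - wallis1"
    by (simp add: algebra_simps power2_eq_square)
  moreover have "coef2 (4 * (z * (w * fps2 a)) - w * (w * fps2 a) - z * (z * fps2 a) - z * (z * (w * (w * fps2 a))) - fps2 a) i j
     = coef2 (fps2_const (sqrt 2) * (z * (w * wallis2)) - fps2_const (sqrt 2) * (w * (w * wallis2))
       + 2 * (z * (w * wallis1)) - z * (z * wallis1) - wallis1) i j"
    using positive_quadrant_coefficients[OF a_def, of i j] unfolding z_def w_def
    by (cases i rule: nat_012_cases; cases j rule: nat_012_cases)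
       (simp_all add: coef2_wallis1 coef2_wallis2 numeral_3_eq_3)
  ultimately show "coef2 (fps2 (\<lambda>x y. if even (x + y) then slit_pot (int x) y else 0) * (4 * z * w - w ^ 2 - z ^ 2 - z ^ 2 * w ^ 2 - 1)) i j
      = coef2 (fps2_const (sqrt 2) * (z * w - w ^ 2) * wallis2 + (2 * z * w - z ^ 2 - 1) * wallis1) i j"
    unfolding a_def by (simp only:)
qed

text \<open>
  As for the positive quadrant, with \<open>m = - x\<close>.  The row \<open>y = 0\<close> is now the slit, and half the
  Laplacian there is up to sign a difference of two consecutive coefficients of \<open>(1 - z\<^sup>2)\<^sup>-\<^sup>1\<^sup>/\<^sup>2\<close>, that is a coefficient of
  \<open>(1 - z\<^sup>2)\<^sup>1\<^sup>/\<^sup>2\<close>.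
\<close>

lemma negative_quadrant_coefficients:
  assumes b: "b = (\<lambda>m y. if m > 0 \<and> even (m + y) then slit_pot (- int m) y else 0)"
  shows "4 * (if i = 0 \<or> j = 0 then 0 else b (i - 1) (j - 1)) - (if i < 2 \<or> j < 2 then 0 else b (i - 2) (j - 2))
      - b i j - (if j < 2 then 0 else b i (j - 2)) - (if i < 2 then 0 else b (i - 2) j)
    = (if i = 2 \<and> j \<ge> 2 then sqrt 2 * wallis (j - 2) else 0) - (if i = 1 \<and> j > 0 then sqrt 2 * wallis (j - 1) else 0)
      + (if i > 0 \<and> j = 1 then wallis (i - 1) else 0) - (if i \<ge> 3 \<and> j = 1 then wallis (i - 3) else 0)"
proof -
  have axis: "b x 0 = 0" for x by (simp add: b slit_pot_even_slit)
  have zero: "b 0 y = 0" for y by (simp add: b)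
  have interior: "b (Suc (Suc (Suc x))) (Suc (Suc y)) + b (Suc x) (Suc (Suc y)) + b (Suc (Suc (Suc x))) y + b (Suc x) y
     = 4 * b (Suc (Suc x)) (Suc y)" for x y
    using slit_pot_harmonic[of "- int (Suc (Suc x))" y] by (simp add: b algebra_simps)
  have column_1: "b 1 y + b 1 (Suc (Suc y)) = sqrt 2 * wallis (Suc y)" for y
    using slit_pot_column_0[of "Suc y"] by (simp add: b wallis_odd slit_pot_column_minus_1)
  have column_2: "4 * b 1 (Suc y) - b 2 (Suc (Suc y)) - b 2 y = sqrt 2 * wallis y" for y
    using slit_pot_harmonic[of "- 1" y] slit_pot_column_0[of y] by (simp add: b wallis_odd)
  have row_1: "b (Suc (Suc (Suc x))) 1 + b (Suc x) 1 = wallis x - wallis (Suc (Suc x))" for x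
  proof (cases "even x")
    case True
    thus ?thesis
      using slit_pot_axis[of "- int (Suc (Suc x))"] slit_pot_even_slit[of "Suc (Suc x)"]
        slit_pot_even_axis[of x] slit_pot_even_axis[of "Suc (Suc x)"]
      by (simp add: b algebra_simps)
  qed (simp add: b wallis_odd)
  have corner: "b 1 1 = sqrt 2 - 1" by (simp add: b slit_pot_minus_1_1)
  have odd0: "b 2 1 = 0" by (simp add: b)
  show ?thesis
  proof (cases j rule: nat_012_cases)
    case 1
    thus ?thesis by (cases i rule: nat_012_cases) (simp_all add: axis)
  next
    case 2
    thus ?thesis
    proof (cases i rule: nat_012_cases)
      case (3 k)
      thus ?thesis using 2 row_1[of "k - 1"] odd0
        by (cases k) (simp_all add: axis zero wallis_Suc_0 numeral_2_eq_2)
    qed (use corner in \<open>simp_all add: axis zero wallis_0\<close>)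
  next
    case (3 m)
    show ?thesis
    proof (cases i rule: nat_012_cases)
      case (3 k)
      thus ?thesis using interior[of "k - 1" m] column_2[of m] \<open>j = Suc (Suc m)\<close>
        by (cases k) (simp_all add: zero numeral_2_eq_2)
    qed (use 3 column_1[of m] in \<open>simp_all add: zero\<close>)
  qed
qed

lemma negative_quadrant:
  fixes z w :: "real fps fps"
  defines "z \<equiv> fps2_var1" and "w \<equiv> fps2_var2"
  shows "fps2 (\<lambda>m y. if m > 0 \<and> even (m + y) then slit_pot (- int m) y else 0)
           * (4 * w * z - w ^ 2 * z ^ 2 - 1 - w ^ 2 - z ^ 2)
         = fps2_const (sqrt 2) * (w ^ 2 * z ^ 2 - w * z) * wallis2 + w * z * (wallis1 * (1 - z ^ 2))"
proof (rule fps2_eqI)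
  fix i j
  define b where "b = (\<lambda>m y. if m > 0 \<and> even (m + y) then slit_pot (- int m) y else 0)"
  have "fps2 b * (4 * w * z - w ^ 2 * z ^ 2 - 1 - w ^ 2 - z ^ 2)
      = 4 * (w * (z * fps2 b)) - w * (w * (z * (z * fps2 b))) - fps2 b - w * (w * fps2 b) - z * (z * fps2 b)"
    by (simp only: right_diff_distrib power2_eq_square mult_1_right) (simp only: mult_ac)
  moreover have "fps2_const (sqrt 2) * (w ^ 2 * z ^ 2 - w * z) * wallis2 + w * z * (wallis1 * (1 - z ^ 2))
      = fps2_const (sqrt 2) * (w * (w * (z * (z * wallis2)))) - fps2_const (sqrt 2) * (w * (z * wallis2))
       + w * (z * wallis1) - w * (z * (z * (z * wallis1)))"
    by (simp add: algebra_simps power2_eq_square)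
  moreover have "coef2 (4 * (w * (z * fps2 b)) - w * (w * (z * (z * fps2 b))) - fps2 b - w * (w * fps2 b) - z * (z * fps2 b)) i j
     = coef2 (fps2_const (sqrt 2) * (w * (w * (z * (z * wallis2)))) - fps2_const (sqrt 2) * (w * (z * wallis2))
       + w * (z * wallis1) - w * (z * (z * (z * wallis1)))) i j"
    using negative_quadrant_coefficients[OF b_def, of i j] unfolding z_def w_def
    by (cases i rule: nat_012_cases; cases j rule: nat_012_cases)
       (simp_all add: coef2_wallis1 coef2_wallis2 numeral_3_eq_3)
  ultimately show "coef2 (fps2 (\<lambda>m y. if m > 0 \<and> even (m + y) then slit_pot (- int m) y else 0) * (4 * w * z - w ^ 2 * z ^ 2 - 1 - w ^ 2 - z ^ 2)) i j
      = coef2 (fps2_const (sqrt 2) * (w ^ 2 * z ^ 2 - w * z) * wallis2 + w * z * (wallis1 * (1 - z ^ 2))) i j"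
    unfolding b_def by (simp only:)
qed

section \<open>The two generating functions\<close>

theorem mainTheorem3:
  shows
    "(let z = fps2_var1; w = fps2_var2 in
        fps2 (\<lambda>x y. if even (x + y) then G_H (int x) (int y) else 0) =
          (fps2_const (sqrt 2) * (z * w - w ^ 2) / fps2_sqrt (1 - w ^ 2)
             + (2 * z * w - z ^ 2 - 1) / fps2_sqrt (1 - z ^ 2))
          / (4 * z * w - w ^ 2 - z ^ 2 - z ^ 2 * w ^ 2 - 1))
     \<and>
     (let z' = fps2_var1; w = fps2_var2 in \<comment> \<open>\<open>z'\<close> stands for \<open>1/z\<close>\<close>
        fps2 (\<lambda>m y. if m > 0 \<and> even (m + y) then G_H (- int m) (int y) else 0) =
          (fps2_const (sqrt 2) * (w ^ 2 * z' ^ 2 - w * z') / fps2_sqrt (1 - w ^ 2)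
             + w * z' * fps2_sqrt (1 - z' ^ 2))
          / (4 * w * z' - w ^ 2 * z' ^ 2 - 1 - w ^ 2 - z' ^ 2))"
proof -
  have right: "(\<lambda>x y. if even (x + y) then G_H (int x) (int y) else 0)
      = (\<lambda>x y. if even (x + y) then slit_pot (int x) y else 0)"
    by (intro ext) (simp add: G_H_eq_slit_pot)
  have left: "(\<lambda>m y. if m > 0 \<and> even (m + y) then G_H (- int m) (int y) else 0)
      = (\<lambda>m y. if m > 0 \<and> even (m + y) then slit_pot (- int m) y else 0)"
    by (intro ext) (auto simp: G_H_eq_slit_pot)
  have var0: "fps_nth (fps_nth fps2_var1 0) 0 = 0" "fps_nth (fps_nth fps2_var2 0) 0 = 0"
    by (simp_all add: fps2_var1_def fps2_var2_def)
  have wallis1_0: "fps_nth (fps_nth wallis1 0) 0 = 1" and wallis2_0: "fps_nth (fps_nth wallis2 0) 0 = 1"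
    using coef2_wallis1[of 0 0] coef2_wallis2[of 0 0] by (simp_all add: coef2_def wallis_0)
  note sqrt1 = fps2_sqrt_wallis[OF wallis1_square wallis1_0 var0(1)]
  note sqrt2 = fps2_sqrt_wallis[OF wallis2_square wallis2_0 var0(2)]
  show ?thesis
    unfolding Let_def right left sqrt1(2) sqrt2(2)
    unfolding sqrt1(1)
    by (intro conjI fps2_divide_eqI[symmetric] positive_quadrant negative_quadrant)
       (simp_all add: var0 power2_eq_square)
qed

end
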